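(* Let $\mathcal{A}$, $X$ and $I$ be as defined in the context, under the standing assumptions listed there. Let $\{(v_n,F_n,Z_n,w_n)\}_{n\in\mathbb{N}}\subset\mathcal{A}$ with $\sup_{n\in\mathbb{N}}I(v_n,F_n,Z_n,w_n)<\infty$. Then there exist $(v,F,Z,w)\in X$ and a subsequence $(v_\mu,F_\mu,Z_\mu,w_\mu)$ such that $$v_\mu\rightharpoonup v\ \text{in } L_2(\Omega),\quad F_\mu\rightharpoonup F\ \text{in } L_p(\Omega),\quad Z_\mu\rightharpoonup Z\ \text{in } L_q(\Omega),\quad w_\mu\rightharpoonup w\ \text{in } L_r(\Omega)$$ (weak convergence). Moreover, $(v,F,Z,w)\in\mathcal{A}$ and $$I(v,F,Z,w)\le\liminf_{n\to\infty}I(v_n,F_n,Z_n,w_n)<\infty.$$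
   Context: Domain: periodic boundary conditions are used, i.e. $\Omega$ is a three-dimensional torus. $\mathbb{M}^3$ denotes real $3\times3$ matrices, $|\cdot|$ a fixed norm on vectors/matrices, $\operatorname{cof}F$ the cofactor matrix (transposed adjugate) of $F$, $\mathbb{R}_+=[0,\infty)$, $\epsilon_{ijk}$ the permutation symbol, $\partial_\alpha=\partial/\partial x_\alpha$; all indices run over $1,2,3$. $W^1_p$ is the Sobolev space of functions with first weak derivatives in $L_p$. A fixed time step $h>0$ is given. Stored energy $W$ and function $G$: (Polyconvexity) $G\colon\mathbb{M}^3\times\mathbb{M}^3\times\mathbb{R}_+\to\mathbb{R}$ is a convex $C^2$-function with $G(F,\operatorname{cof}F,\det F)=W(F)$ for all $F\in\mathbb{M}^3$ with $\det F\ge0$. (Coercivity) There are $C_1>0$, $C_2\in\mathbb{R}$, $p\ge3$, $q,r\ge2$ with $G(F,Z,w)\ge C_1(|F|^p+|Z|^q+w^r)+C_2$. (Growth) There is $c>0$ with $G(F,Z,w)\le c(|F|^p+|Z|^q+w^r+1)$. (Derivative growth) There is $C>0$ with $|\partial_FG|^{p'}+|\partial_ZG|^{\frac{pp'}{p-p'}}+|\partial_wG|^{\frac{pp'}{p-2p'}}\le C(|F|^p+|Z|^q+w^r+1)$, where $p'=\frac{p}{p-1}$ if $p>3$ and $p'<\frac32$ if $p=3$. Mappings with finite distortion: $f\in FD(\Omega)$, $f\colon\Omega\to\mathbb{R}^3$, means $f\in W^1_{1,\mathrm{loc}}(\Omega)$, $J(x,f)=\det Df(x)\ge0$ a.e.,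 and $|Df(x)|^3\le K(x)J(x,f)$ a.e. for some $K$ with $1\le K(x)<\infty$ a.e. A function $M\in L_s(\Omega)$, $s>2$, is given. Initial data: $y^0\in W^1_p(\Omega)\cap FD(\Omega)$, $v^0\in L_2(\Omega)$, $F^0=Dy^0\in L_p(\Omega)$, $Z^0=\operatorname{cof}Dy^0\in L_q(\Omega)$, $w^0=\det Dy^0\in L_r(\Omega)$, $|F^0(x)|^3\le M(x)w^0(x)$ and $w^0(x)\ge0$ a.e. in $\Omega$, and $\int_\Omega\frac12(v^0)^2+G(F^0,Z^0,w^0)\,dx<\infty$. Functional: $I(v,F,Z,w)=\int_\Omega\frac12|v-v^0|^2+G(F,Z,w)\,dx$. Space and admissible set: $X=L_2(\Omega)\times L_p(\Omega)\times L_q(\Omega)\times L_r(\Omega)$ ($v$ being $\mathbb{R}^3$-valued, $F,Z$ being $\mathbb{M}^3$-valued, $w$ scalar). $\mathcal{A}$ is the set of $(v,F,Z,w)\in X$ such that $I(v,F,Z,w)<\infty$, $|F(x)|^3\le M(x)w(x)$ a.e. in $\Omega$, $w(x)\ge0$ a.e. in $\Omega$, and for every scalar test function $\theta\in C_0^\infty(\Omega)$ and all indices $i,\alpha,k,\gamma$: $$\int_\Omega\theta\tfrac1h(F_{i\alpha}-F^0_{i\alpha})\,dx=-\int_\Omega v_i\,\partial_\alpha\theta\,dx,$$ $$\int_\Omega\theta\tfrac1h(Z_{k\gamma}-Z^0_{k\gamma})\,dx=-\int_\Omega\sum_{i,j,\alpha,\beta}\epsilon_{ijk}\epsilon_{\alpha\beta\gamma}F^0_{j\beta}v_i\,\partial_\alpha\theta\,dx,$$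 $$\int_\Omega\theta\tfrac1h(w-w^0)\,dx=-\int_\Omega\sum_{i,\alpha}(\operatorname{cof}F^0)_{i\alpha}v_i\,\partial_\alpha\theta\,dx.$$ *)

theory Defs
  imports "HOL-Analysis.Analysis"
begin

definition is_norm :: "('a::real_vector \<Rightarrow> real) \<Rightarrow> bool" where
  "is_norm N \<longleftrightarrow>
     (\<forall>x. 0 \<le> N x) \<and> (\<forall>x. N x = 0 \<longleftrightarrow> x = 0) \<and>
     (\<forall>c x. N (c *\<^sub>R x) = \<bar>c\<bar> * N x) \<and> (\<forall>x y. N (x + y) \<le> N x + N y)"

text \<open>Entry \<open>(i, a)\<close> is the determinant of \<open>A\<close> with row \<open>i\<close> replaced by the unit vector
  \<open>e\<^sub>a\<close>, that is, the signed minor.\<close>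

definition cof :: "real^'n^'n \<Rightarrow> real^'n^'n" where
  "cof A = (\<chi> i a. det (\<chi> k. if k = i then axis a 1 else A $ k))"

text \<open>In type \<^typ>\<open>3\<close> the numeral \<open>3\<close> equals \<open>0\<close>; the three indices are \<open>1, 2, 3\<close>.\<close>

definition perm_symbol :: "3 \<Rightarrow> 3 \<Rightarrow> 3 \<Rightarrow> real" where
  "perm_symbol i j k =
     (if (i, j, k) \<in> {(1, 2, 3), (2, 3, 1), (3, 1, 2)} then 1
      else if (i, j, k) \<in> {(3, 2, 1), (1, 3, 2), (2, 1, 3)} then -1 else 0)"

text \<open>The torus with periods \<open>l $ 1, l $ 2, l $ 3 > 0\<close>. As a measure space it is the period cell
  (opposite faces are null sets, so identifying them changes nothing). Its topology enters only
  through the test functions, which are the smooth \<open>l\<close>-periodic functions on the whole space.\<close>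

definition torus :: "real^3 \<Rightarrow> (real^3) measure" where
  "torus l = lebesgue_on (cbox 0 l)"

definition pd :: "3 \<Rightarrow> (real^3 \<Rightarrow> real) \<Rightarrow> real^3 \<Rightarrow> real" where
  "pd a f x = frechet_derivative f (at x) (axis a 1)"

definition smooth :: "(real^3 \<Rightarrow> real) \<Rightarrow> bool" where
  "smooth f \<longleftrightarrow> (\<forall>as. foldr pd as f differentiable_on UNIV)"

text \<open>The torus is compact, so compact support is no restriction.\<close>

definition test_functions :: "real^3 \<Rightarrow> (real^3 \<Rightarrow> real) set" where
  "test_functions l = {\<theta>. smooth \<theta> \<and> (\<forall>x i. \<theta> (x + axis i (l $ i)) = \<theta> x)}"

text \<open>Elements of the Lebesgue spaces are represented by functions, not by classes modulo
  almost-everywhere equality.\<close>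

definition Lsp :: "'a measure \<Rightarrow> real \<Rightarrow> ('a \<Rightarrow> 'b::euclidean_space) set" where
  "Lsp M p = {f \<in> borel_measurable M. integrable M (\<lambda>x. norm (f x) powr p)}"

definition Lnorm :: "'a measure \<Rightarrow> real \<Rightarrow> ('a \<Rightarrow> 'b::euclidean_space) \<Rightarrow> real" where
  "Lnorm M p f = (LINT x|M. norm (f x) powr p) powr (1 / p)"

text \<open>The bounded linear functionals on the space. The norm bound makes them invariant under
  almost-everywhere equality.\<close>

definition Ldual :: "'a measure \<Rightarrow> real \<Rightarrow> (('a \<Rightarrow> 'b::euclidean_space) \<Rightarrow> real) set" where
  "Ldual M p = {\<phi>.
     (\<forall>f\<in>Lsp M p. \<forall>g\<in>Lsp M p. \<phi> (\<lambda>x. f x + g x) = \<phi> f + \<phi> g) \<and>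
     (\<forall>c. \<forall>f\<in>Lsp M p. \<phi> (\<lambda>x. c *\<^sub>R f x) = c * \<phi> f) \<and>
     (\<exists>C. \<forall>f\<in>Lsp M p. \<bar>\<phi> f\<bar> \<le> C * Lnorm M p f)}"

definition weakly_converges ::
  "'a measure \<Rightarrow> real \<Rightarrow> (nat \<Rightarrow> 'a \<Rightarrow> 'b::euclidean_space) \<Rightarrow> ('a \<Rightarrow> 'b) \<Rightarrow> bool" where
  "weakly_converges M p u f \<longleftrightarrow>
     (\<forall>n. u n \<in> Lsp M p) \<and> f \<in> Lsp M p \<and>
     (\<forall>\<phi>\<in>Ldual M p. (\<lambda>n. \<phi> (u n)) \<longlonglongrightarrow> \<phi> f)"

text \<open>Periodic boundary conditions for a deformation \<open>y\<close>: the displacement \<open>y x - A x\<close> is a function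
  on the torus, where \<open>A\<close> is the mean deformation gradient. The case \<open>A = 0\<close> is that of a map \<open>y\<close>
  which is itself periodic; for exponents \<open>p \<ge> 3\<close> such a map has \<open>det (Dy)\<close> of mean value zero, so
  that \<open>det (Dy) \<ge> 0\<close> leaves only \<open>det (Dy) = 0\<close>, whence the general \<open>A\<close>.
  Matrix entries: \<open>Dy $ i $ a\<close> is the derivative of \<open>y $ i\<close> in direction \<open>a\<close>.\<close>

definition weak_gradient ::
  "real^3 \<Rightarrow> real^3^3 \<Rightarrow> (real^3 \<Rightarrow> real^3) \<Rightarrow> (real^3 \<Rightarrow> real^3^3) \<Rightarrow> bool" where
  "weak_gradient l A y Dy \<longleftrightarrow>
     y \<in> Lsp (torus l) 1 \<and> Dy \<in> Lsp (torus l) 1 \<and>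
     (\<forall>\<theta>\<in>test_functions l. \<forall>i a.
        (LINT x|torus l. (y x - A *v x) $ i * pd a \<theta> x) =
        - (LINT x|torus l. (Dy x - A) $ i $ a * \<theta> x))"

definition W1 :: "real^3 \<Rightarrow> real^3^3 \<Rightarrow> real \<Rightarrow> (real^3 \<Rightarrow> real^3) set" where
  "W1 l A p = {y \<in> Lsp (torus l) p. \<exists>Dy \<in> Lsp (torus l) p. weak_gradient l A y Dy}"

text \<open>Mappings with finite distortion. By compactness of the torus, the local Sobolev space with
  exponent \<open>1\<close> is the global one.\<close>

definition FD :: "(real^3^3 \<Rightarrow> real) \<Rightarrow> real^3 \<Rightarrow> real^3^3 \<Rightarrow> (real^3 \<Rightarrow> real^3) set" where
  "FD N l A = {y \<in> W1 l A 1. \<exists>Dy. weak_gradient l A y Dy \<and>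
     (AE x in torus l. 0 \<le> det (Dy x)) \<and>
     (\<exists>K::real^3 \<Rightarrow> real. AE x in torus l. 1 \<le> K x \<and> N (Dy x) ^ 3 \<le> K x * det (Dy x))}"

text \<open>The closed half-space of arguments \<open>(F, Z, w)\<close> with \<open>w \<ge> 0\<close>.\<close>

definition half_space :: "((real^3^3) \<times> (real^3^3) \<times> real) set" where
  "half_space = UNIV \<times> UNIV \<times> {0..}"

text \<open>Derivatives are taken within \<open>S\<close>; on a convex set with interior points they are unique.\<close>

definition C2_on :: "'a::euclidean_space set \<Rightarrow> ('a \<Rightarrow> real) \<Rightarrow> bool" where
  "C2_on S f \<longleftrightarrow> (\<exists>(f' :: 'a \<Rightarrow> 'a \<Rightarrow>\<^sub>L real) (f'' :: 'a \<Rightarrow> 'a \<Rightarrow>\<^sub>L 'a \<Rightarrow>\<^sub>L real).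
     (\<forall>x\<in>S. (f has_derivative blinfun_apply (f' x)) (at x within S)) \<and>
     (\<forall>x\<in>S. (f' has_derivative blinfun_apply (f'' x)) (at x within S)) \<and>
     continuous_on S f'')"

text \<open>Lebesgue integral with values in the extended reals, well defined for measurable functions
  whose negative part has finite integral.\<close>

definition ext_integral :: "'a measure \<Rightarrow> ('a \<Rightarrow> real) \<Rightarrow> ereal" where
  "ext_integral M f =
     enn2ereal (\<integral>\<^sup>+x. ennreal (f x) \<partial>M) - enn2ereal (\<integral>\<^sup>+x. ennreal (- f x) \<partial>M)"

type_synonym state =
  "(real^3 \<Rightarrow> real^3) \<times> (real^3 \<Rightarrow> real^3^3) \<times> (real^3 \<Rightarrow> real^3^3) \<times> (real^3 \<Rightarrow> real)"

definition functional_I ::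
  "real^3 \<Rightarrow> (real^3 \<Rightarrow> real) \<Rightarrow> ((real^3^3) \<times> (real^3^3) \<times> real \<Rightarrow> real) \<Rightarrow>
   (real^3 \<Rightarrow> real^3) \<Rightarrow> state \<Rightarrow> ereal" where
  "functional_I l Nv G v0 = (\<lambda>(v, F, Z, w).
     ext_integral (torus l) (\<lambda>x. 1/2 * Nv (v x - v0 x) ^ 2 + G (F x, Z x, w x)))"

definition space_X :: "real^3 \<Rightarrow> real \<Rightarrow> real \<Rightarrow> real \<Rightarrow> state set" where
  "space_X l p q r = Lsp (torus l) 2 \<times> Lsp (torus l) p \<times> Lsp (torus l) q \<times> Lsp (torus l) r"

text \<open>\<open>F0, Z0, w0\<close> are the gradient, cofactor matrix and determinant at the previous time step.\<close>

definition admissible ::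
  "real^3 \<Rightarrow> (real^3 \<Rightarrow> real) \<Rightarrow> (real^3^3 \<Rightarrow> real) \<Rightarrow> ((real^3^3) \<times> (real^3^3) \<times> real \<Rightarrow> real) \<Rightarrow>
   real \<Rightarrow> real \<Rightarrow> real \<Rightarrow> real \<Rightarrow> (real^3 \<Rightarrow> real) \<Rightarrow>
   (real^3 \<Rightarrow> real^3) \<Rightarrow> (real^3 \<Rightarrow> real^3^3) \<Rightarrow> (real^3 \<Rightarrow> real^3^3) \<Rightarrow> (real^3 \<Rightarrow> real) \<Rightarrow>
   state set" where
  "admissible l Nv Nm G h p q r M v0 F0 Z0 w0 = {(v, F, Z, w).
     (v, F, Z, w) \<in> space_X l p q r \<and>
     functional_I l Nv G v0 (v, F, Z, w) < \<infinity> \<and>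
     (AE x in torus l. Nm (F x) ^ 3 \<le> M x * w x) \<and>
     (AE x in torus l. 0 \<le> w x) \<and>
     (\<forall>\<theta>\<in>test_functions l.
        (\<forall>i a. (LINT x|torus l. \<theta> x * (1/h * (F x $ i $ a - F0 x $ i $ a))) =
               - (LINT x|torus l. v x $ i * pd a \<theta> x)) \<and>
        (\<forall>k c. (LINT x|torus l. \<theta> x * (1/h * (Z x $ k $ c - Z0 x $ k $ c))) =
               - (LINT x|torus l. (\<Sum>i\<in>UNIV. \<Sum>j\<in>UNIV. \<Sum>a\<in>UNIV. \<Sum>b\<in>UNIV.
                    perm_symbol i j k * perm_symbol a b c * F0 x $ j $ b * v x $ i * pd a \<theta> x))) \<and>
        (LINT x|torus l. \<theta> x * (1/h * (w x - w0 x))) =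
          - (LINT x|torus l. (\<Sum>i\<in>UNIV. \<Sum>a\<in>UNIV. cof (F0 x) $ i $ a * v x $ i * pd a \<theta> x)))}"

end

(* All exponents are at least 2 and the torus has finite measure, so the whole state (v, F, Z, w) is
   a bounded sequence in one Hilbert space L2. A weakly convergent subsequence exists there, and
   bounded test functions suffice to upgrade its components to weak convergence in L_p, L_q, L_r,
   because the functionals on these spaces are represented by the Euler equation of a minimiser
   (Clarkson's inequality). By Banach-Saks, Cesaro means of a subsequence converge almost everywhere;
   since the distortion inequality |F|^3 <= M w is a closed convex condition on (F, w), and the
   integrand is convex, the means carry both the pointwise constraints and, by Jensen and Fatou, the
   lower semicontinuity to the limit. The remaining constraints are linear with test fields in L2. *)

theory Submission
  imports Defs "HOL-Complex_Analysis.Great_Picard"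
begin

subsection \<open>Convexity of powers\<close>

text \<open>Weak convergence of the components one by one would not do: the distortion condition
  couples \<open>F\<close> with \<open>w\<close>, and the integrand couples \<open>F\<close>,
  \<open>Z\<close> and \<open>w\<close>, so the same averages must be applied to all components at
  once. This is the reason for treating the state as a single vector-valued function. The function
  \<open>G\<close> is given for \<open>w \<ge> 0\<close> only. Convexity is thus available only on
  that half-space, and the averages and the limit must be known to stay there before continuity can
  be used. Fatou's lemma asks for a nonnegative integrand; subtracting \<open>C2\<close> provides
  one and, on a space of finite measure, changes the functional by a finite constant. The
  constraints are linear because their coefficients \<open>F0\<close> and \<open>cof (F0 x)\<close>
  are frozen at the previous time step. For p > 2 the functionals on L_p are represented by
  functions of the conjugate exponent, which need not lie in L2. Truncation turns them into bounded
  test functions, and the L_p bound of the sequence makes the truncation error uniformly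
  small.\<close>

lemma convex_on_powr_nonneg:
  fixes p :: real
  assumes "1 \<le> p"
  shows "convex_on {0..} (\<lambda>x. x powr p)"
proof (rule convex_onI)
  show "convex {0::real..}" by simp
next
  fix t x y :: real
  assume t: "0 < t" "t < 1" and xy: "x \<in> {0..}" "y \<in> {0..}"
  \<comment> \<open>If one argument is 0, convexity reduces to this inequality, that is, to
    \<open>u powr p \<le> u\<close> for \<open>0 < u < 1\<close>.\<close>
  have scale: "(u * z) powr p \<le> u * z powr p" if "0 < u" "u < 1" "0 \<le> z" for u z :: real
  proof -
    have "u powr p \<le> u powr 1" by (intro powr_mono') (use that assms in auto)
    thus ?thesis using that by (simp add: powr_mult mult_right_mono)
  qed
  consider "x = 0" | "y = 0" | "x > 0" "y > 0" using xy by fastforce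
  then show "((1 - t) *\<^sub>R x + t *\<^sub>R y) powr p \<le> (1 - t) * x powr p + t * y powr p"
  proof cases
    case 3
    then show ?thesis using convex_onD[OF powr_convex[OF assms], of t x y] t by simp
  qed (use scale[of t y] scale[of "1 - t" x] t xy in auto)
qed

lemma convex_on_compose_mono:
  fixes N :: "'a::real_vector \<Rightarrow> real" and g :: "real \<Rightarrow> real"
  assumes "convex_on S N" "convex_on {0..} g" "mono_on {0..} g" "\<And>x. 0 \<le> N x"
  shows "convex_on S (\<lambda>x. g (N x))"
proof (rule convex_onI)
  show "convex S" using assms(1) by (rule convex_on_imp_convex)
next
  fix t :: real and x y assume t: "0 < t" "t < 1" and xy: "x \<in> S" "y \<in> S"
  have "g (N ((1 - t) *\<^sub>R x + t *\<^sub>R y)) \<le> g ((1 - t) * N x + t * N y)"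
    using t by (intro mono_onD[OF assms(3)]) (auto intro!: convex_onD[OF assms(1)] simp: assms(4) xy)
  also have "\<dots> \<le> (1 - t) * g (N x) + t * g (N y)"
    using convex_onD[OF assms(2), of t "N x" "N y"] t assms(4) by simp
  finally show "g (N ((1 - t) *\<^sub>R x + t *\<^sub>R y)) \<le> (1 - t) * g (N x) + t * g (N y)" .
qed

lemma mono_on_powr_nonneg: "0 \<le> (p::real) \<Longrightarrow> mono_on {0..} (\<lambda>x::real. x powr p)"
  by (intro mono_onI powr_mono2) auto

text \<open>Write \<open>z powr r\<close> as \<open>z * z powr (r - 1)\<close> and enlarge the
  second factor to \<open>(x + y) powr (r - 1)\<close>.\<close>

lemma powr_add_le:
  fixes x y r :: real
  assumes "0 \<le> x" "0 \<le> y" "1 \<le> r"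
  shows "x powr r + y powr r \<le> (x + y) powr r"
proof -
  have split: "z powr r = z * z powr (r - 1)" if "0 \<le> z" for z :: real
    using that by (cases "z = 0") (auto simp: powr_diff)
  have "x powr r \<le> x * (x + y) powr (r - 1)" "y powr r \<le> y * (x + y) powr (r - 1)"
    unfolding split[OF assms(1)] split[OF assms(2)]
    using assms by (auto intro!: mult_left_mono powr_mono2)
  hence "x powr r + y powr r \<le> (x + y) * (x + y) powr (r - 1)" by (simp add: distrib_right)
  thus ?thesis using split[of "x + y"] assms by simp
qed

text \<open>The parallelogram law handles the squares. Superadditivity of
  \<open>t powr (p / 2)\<close> merges the left-hand side into the power of a sum, and convexity of
  the same function splits that power into the mean on the right. Both rest on
  \<open>p / 2 \<ge> 1\<close>.\<close>

lemma Clarkson_powr: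
  fixes a b :: "'a::real_inner"
  assumes "2 \<le> p"
  shows "norm ((1/2) *\<^sub>R (a + b)) powr p + norm ((1/2) *\<^sub>R (a - b)) powr p
         \<le> (norm a powr p + norm b powr p) / 2"
proof -
  define x y where "x = norm ((1/2) *\<^sub>R (a + b))" and "y = norm ((1/2) *\<^sub>R (a - b))"
  have sq: "z powr p = (z\<^sup>2) powr (p / 2)" if "0 \<le> z" for z :: real
    using that by (cases "z = 0") (auto simp: powr_powr simp flip: powr_numeral)
  have par: "x\<^sup>2 + y\<^sup>2 = ((norm a)\<^sup>2 + (norm b)\<^sup>2) / 2"
    by (simp add: x_def y_def power2_norm_eq_inner power_mult_distrib power_divide inner_add inner_diff inner_commute field_simps)
  have "x powr p + y powr p = (x\<^sup>2) powr (p / 2) + (y\<^sup>2) powr (p / 2)"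
    by (simp add: sq x_def y_def)
  also have "\<dots> \<le> (x\<^sup>2 + y\<^sup>2) powr (p / 2)" using assms by (intro powr_add_le) auto
  also have "\<dots> = ((1 - 1/2) * (norm a)\<^sup>2 + 1/2 * (norm b)\<^sup>2) powr (p / 2)"
    unfolding par by (simp add: field_simps)
  also have "\<dots> \<le> (1 - 1/2) * ((norm a)\<^sup>2) powr (p / 2) + 1/2 * ((norm b)\<^sup>2) powr (p / 2)"
    using convex_onD[OF convex_on_powr_nonneg[of "p/2"], of "1/2" "(norm a)\<^sup>2" "(norm b)\<^sup>2"] assms by simp
  also have "\<dots> = (norm a powr p + norm b powr p) / 2" by (simp add: sq)
  finally show ?thesis by (simp add: x_def y_def)
qed

lemma norm_add_powr_le:
  fixes a b :: "'a::real_normed_vector"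
  assumes "0 \<le> p"
  shows "norm (a + b) powr p \<le> 2 powr p * (norm a powr p + norm b powr p)"
proof -
  have "norm (a + b) powr p \<le> (2 * max (norm a) (norm b)) powr p"
    using norm_triangle_ineq[of a b] assms by (intro powr_mono2) auto
  also have "\<dots> = 2 powr p * max (norm a) (norm b) powr p" by (simp add: powr_mult)
  also have "\<dots> \<le> 2 powr p * (norm a powr p + norm b powr p)"
    by (intro mult_left_mono) (auto simp: max_def)
  finally show ?thesis .
qed

text \<open>The gradient of \<open>norm y powr p\<close> is \<open>p\<close> times this map.\<close>

definition duality_map :: "real \<Rightarrow> 'a::real_inner \<Rightarrow> 'a" where
  "duality_map p y = norm y powr (p - 2) *\<^sub>R y"

lemma norm_duality_map: "norm (duality_map p y) = norm y powr (p - 1)"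
proof (cases "y = 0")
  case False
  then have "norm y powr (p - 2) * norm y = norm y powr (p - 2) * norm y powr 1" by simp
  also have "\<dots> = norm y powr (p - 1)" by (subst powr_add[symmetric]) simp
  finally show ?thesis by (simp add: duality_map_def)
qed (simp add: duality_map_def)

lemma inner_duality_map: "duality_map p y \<bullet> y = norm y powr p"
proof (cases "y = 0")
  case False
  then have "norm y powr (p - 2) * (y \<bullet> y) = norm y powr (p - 2) * norm y powr 2"
    by (simp add: dot_square_norm)
  also have "\<dots> = norm y powr p" by (subst powr_add[symmetric]) simp
  finally show ?thesis by (simp add: duality_map_def)
qed (simp add: duality_map_def)

text \<open>Makes L2 pairings the case \<open>p = 2\<close> of the results on
  \<open>duality_map\<close>. At the origin \<open>0 powr 0 = 0\<close>, but there the factor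
  \<open>y\<close> vanishes as well.\<close>

lemma duality_map_2 [simp]: "duality_map 2 y = y"
  by (cases "y = 0") (auto simp: duality_map_def)

text \<open>At 0 the factor \<open>norm y powr (p - 2)\<close> is unbounded nearby when
  \<open>p < 2\<close>, so the limit is read off from the norm \<open>norm y powr (p - 1)\<close> of
  the product.\<close>

lemma isCont_duality_map:
  assumes "1 < p" shows "isCont (duality_map p) y"
proof (cases "y = 0")
  case True
  have "((\<lambda>z::'a. norm z powr (p - 1)) \<longlongrightarrow> norm (0::'a) powr (p - 1)) (at 0)"
    using assms by (intro tendsto_powr2 tendsto_intros) auto
  hence "((\<lambda>z. norm (duality_map p (z::'a))) \<longlongrightarrow> 0) (at 0)"
    using assms by (simp add: norm_duality_map)
  hence "(duality_map p \<longlongrightarrow> (0::'a)) (at 0)" by (rule tendsto_norm_zero_cancel)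
  thus ?thesis unfolding True isCont_def by (simp add: duality_map_def)
next
  case False
  then show ?thesis unfolding duality_map_def by (intro continuous_intros) auto
qed

lemma borel_measurable_duality_map [measurable]:
  "duality_map p \<in> borel_measurable (borel :: 'a::euclidean_space measure)"
  unfolding duality_map_def by measurable

text \<open>Young's inequality for the exponents \<open>p\<close> and \<open>p / (p - 1)\<close>,
  applied to \<open>y\<close> and \<open>x powr (p - 1)\<close>. The endpoint 0 is thereby covered
  without derivatives.\<close>

lemma powr_ge_tangent:
  fixes x y p :: real
  assumes "1 < p" "0 \<le> x" "0 \<le> y"
  shows "x powr p + p * x powr (p - 1) * (y - x) \<le> y powr p"
proof -
  define q where "q = p / (p - 1)"
  have q: "q > 1" "1 / p + 1 / q = 1" using assms by (auto simp: q_def field_simps)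
  have "y * x powr (p - 1) \<le> y powr p / p + (x powr (p - 1)) powr q / q"
    using assms q by (intro Youngs_inequality) auto
  also have "(x powr (p - 1)) powr q = x powr p" using assms by (simp add: powr_powr q_def)
  finally have "p * (y * x powr (p - 1)) \<le> y powr p + p * x powr p - x powr p"
    using assms by (simp add: q_def field_simps)
  moreover have xx: "x * x powr (p - 1) = x powr p"
    using assms by (cases "x = 0") (auto simp: powr_diff)
  have "p * x powr (p - 1) * (y - x) = p * (y * x powr (p - 1)) - p * x powr p"
    unfolding xx[symmetric] by (simp add: algebra_simps)
  ultimately show ?thesis by linarith
qed

text \<open>Cauchy-Schwarz replaces the inner product by a product of norms, which leaves the scalar
  tangent inequality. Thus \<open>p\<close> times \<open>duality_map p c\<close> is a subgradient of
  the p-th power of the norm at \<open>c\<close>.\<close>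

lemma norm_powr_ge_tangent:
  fixes c d :: "'a::real_inner"
  assumes "1 < p"
  shows "norm c powr p + p * (duality_map p c \<bullet> (d - c)) \<le> norm d powr p"
proof -
  have "duality_map p c \<bullet> (d - c) = norm c powr (p - 2) * (c \<bullet> d) - norm c powr p"
    by (simp add: inner_diff_right inner_duality_map) (simp add: duality_map_def)
  also have "\<dots> \<le> norm c powr (p - 2) * (norm c * norm d) - norm c powr p"
    by (intro diff_mono mult_left_mono norm_cauchy_schwarz) auto
  also have "\<dots> = norm c powr (p - 1) * norm d - norm c powr p"
    using norm_duality_map[of p c] by (simp add: duality_map_def)
  also have "norm c powr p = norm c powr (p - 1) * norm c"
    by (cases "c = 0") (auto simp: powr_diff)
  finally have "duality_map p c \<bullet> (d - c) \<le> norm c powr (p - 1) * (norm d - norm c)"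
    by (simp add: right_diff_distrib)
  hence "p * (duality_map p c \<bullet> (d - c)) \<le> p * norm c powr (p - 1) * (norm d - norm c)"
    using assms by (simp add: mult.assoc)
  thus ?thesis using powr_ge_tangent[OF assms, of "norm c" "norm d"] by simp
qed

text \<open>A weighted Young inequality, by a case split on which term dominates. The weight
  \<open>\<delta>\<close> goes to a quantity that is merely bounded, \<open>1 / \<delta>\<close> to
  one that can be made small afterwards. In the second case
  \<open>\<delta> powr (p - 1) \<le> \<delta>\<close> uses \<open>p \<ge> 2\<close>.\<close>

lemma powr_mult_le_weighted:
  fixes a b \<delta> p :: real
  assumes "0 \<le> a" "0 \<le> b" "0 < \<delta>" "\<delta> \<le> 1" "2 \<le> p"
  shows "a powr (p - 1) * b \<le> \<delta> * b powr p + a powr p / \<delta>"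
proof (cases "\<delta> * b \<le> a")
  case True
  have "a powr (p - 1) * b \<le> a powr (p - 1) * (a / \<delta>)"
    using True assms by (intro mult_left_mono) (auto simp: field_simps)
  also have "\<dots> = a powr p / \<delta>" using assms by (cases "a = 0") (auto simp: powr_diff)
  finally show ?thesis using assms by (smt (verit) mult_nonneg_nonneg powr_ge_zero)
next
  case False
  hence "a powr (p - 1) * b \<le> (\<delta> * b) powr (p - 1) * b"
    using assms by (intro mult_right_mono powr_mono2) auto
  also have "\<dots> = \<delta> powr (p - 1) * b powr p"
    using assms by (cases "b = 0") (auto simp: powr_mult powr_diff)
  also have "\<dots> \<le> \<delta> powr 1 * b powr p"
    using assms by (intro mult_right_mono powr_mono') auto
  finally show ?thesis using assms by (smt (verit) divide_nonneg_pos powr_ge_zero powr_one)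
qed

subsection \<open>Completeness and representation of functionals\<close>

text \<open>The p-th power of \<open>Lnorm\<close>. Clarkson's inequality, the tangent inequality
  and Fatou's lemma act on the integral of the power; the root enters only through
  \<open>Ldual\<close>.\<close>

definition power_integral :: "'a measure \<Rightarrow> real \<Rightarrow> ('a \<Rightarrow> 'b::euclidean_space) \<Rightarrow> real" where
  "power_integral M p f = (LINT x|M. norm (f x) powr p)"

lemma power_integral_nonneg [simp]: "0 \<le> power_integral M p f"
  by (simp add: power_integral_def)

lemma Lnorm_power_integral: "Lnorm M p f = power_integral M p f powr (1 / p)"
  by (simp add: Lnorm_def power_integral_def)

lemma LspD [dest]:
  assumes "f \<in> Lsp M p"
  shows "f \<in> borel_measurable M" "integrable M (\<lambda>x. norm (f x) powr p)"
  using assms by (auto simp: Lsp_def)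

lemma LspI_bound:
  assumes "f \<in> borel_measurable M" "integrable M g" "AE x in M. norm (f x) powr p \<le> g x"
  shows "f \<in> Lsp M p"
proof -
  have "integrable M (\<lambda>x. norm (f x) powr p)"
    using assms(2) by (rule Bochner_Integration.integrable_bound) (use assms in \<open>auto elim: eventually_mono\<close>)
  thus ?thesis using assms(1) by (simp add: Lsp_def)
qed

lemma LspI_nn_integral:
  assumes "f \<in> borel_measurable M" "(\<integral>\<^sup>+x. ennreal (norm (f x) powr p) \<partial>M) \<le> ennreal C" "0 \<le> C"
  shows "f \<in> Lsp M p" "power_integral M p f \<le> C"
proof -
  have "integrable M (\<lambda>x. norm (f x) powr p)"
    using assms by (intro integrableI_nonneg) (auto simp: le_less_trans)
  thus "f \<in> Lsp M p" using assms by (simp add: Lsp_def)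
  have "ennreal (power_integral M p f) \<le> ennreal C"
    unfolding power_integral_def using \<open>integrable _ _\<close> assms(2) by (simp add: nn_integral_eq_integral)
  thus "power_integral M p f \<le> C" using assms(3) by simp
qed

lemma nn_integral_norm_powr:
  "f \<in> Lsp M p \<Longrightarrow> (\<integral>\<^sup>+x. ennreal (norm (f x) powr p) \<partial>M) = ennreal (power_integral M p f)"
  unfolding power_integral_def by (auto intro!: nn_integral_eq_integral)

lemma Lsp_add:
  assumes "0 \<le> p" "f \<in> Lsp M p" "g \<in> Lsp M p"
  shows "(\<lambda>x. f x + g x) \<in> Lsp M p"
proof (rule LspI_bound)
  show "integrable M (\<lambda>x. 2 powr p * (norm (f x) powr p + norm (g x) powr p))"
    using assms by auto
qed (use assms norm_add_powr_le in \<open>auto intro!: borel_measurable_add\<close>)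

lemma power_integral_add_le:
  assumes "0 \<le> p" "f \<in> Lsp M p" "g \<in> Lsp M p"
  shows "power_integral M p (\<lambda>x. f x + g x) \<le> 2 powr p * (power_integral M p f + power_integral M p g)"
proof -
  have "power_integral M p (\<lambda>x. f x + g x) \<le> (LINT x|M. 2 powr p * (norm (f x) powr p + norm (g x) powr p))"
    unfolding power_integral_def
  proof (intro integral_mono LspD(2) Lsp_add assms norm_add_powr_le)
    show "integrable M (\<lambda>x. 2 powr p * (norm (f x) powr p + norm (g x) powr p))"
      using LspD(2)[OF assms(2)] LspD(2)[OF assms(3)] by simp
  qed
  also have "\<dots> = 2 powr p * (power_integral M p f + power_integral M p g)"
    unfolding power_integral_def using LspD(2)[OF assms(2)] LspD(2)[OF assms(3)] by simp
  finally show ?thesis .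
qed

lemma power_integral_scaleR:
  "power_integral M p (\<lambda>x. c *\<^sub>R f x) = \<bar>c\<bar> powr p * power_integral M p f"
  by (simp add: power_integral_def powr_mult)

lemma Lsp_scaleR:
  assumes "f \<in> Lsp M p" shows "(\<lambda>x. c *\<^sub>R f x) \<in> Lsp M p"
  using assms by (auto simp: Lsp_def powr_mult)

lemma Lsp_0 [simp]: "(\<lambda>x. 0) \<in> Lsp M p"
  by (simp add: Lsp_def)

lemma Lsp_diff:
  assumes "0 \<le> p" "f \<in> Lsp M p" "g \<in> Lsp M p"
  shows "(\<lambda>x. f x - g x) \<in> Lsp M p"
  using Lsp_add[OF assms(1,2) Lsp_scaleR[OF assms(3), of "-1"]] by simp

lemma power_integral_diff_commute:
  "power_integral M p (\<lambda>x. f x - g x) = power_integral M p (\<lambda>x. g x - f x)"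
  by (simp add: power_integral_def norm_minus_commute)

text \<open>Fatou's lemma: along an a.e. convergent sequence the lower limit of the integrands is
  their limit.\<close>

lemma nn_integral_le_of_AE_tendsto:
  fixes g :: "nat \<Rightarrow> 'a \<Rightarrow> real"
  assumes "\<And>n. g n \<in> borel_measurable M" "AE x in M. (\<lambda>n. g n x) \<longlonglongrightarrow> g' x"
    and le: "eventually (\<lambda>n. (\<integral>\<^sup>+x. ennreal (g n x) \<partial>M) \<le> C) sequentially"
  shows "(\<integral>\<^sup>+x. ennreal (g' x) \<partial>M) \<le> C"
proof -
  have "(\<integral>\<^sup>+x. ennreal (g' x) \<partial>M) = (\<integral>\<^sup>+x. liminf (\<lambda>n. ennreal (g n x)) \<partial>M)"
  proof (rule nn_integral_cong_AE, use assms(2) in eventually_elim)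
    case (elim x)
    then show ?case by (intro lim_imp_Liminf[symmetric] tendsto_ennrealI) auto
  qed
  also have "\<dots> \<le> liminf (\<lambda>n. \<integral>\<^sup>+x. ennreal (g n x) \<partial>M)"
    using assms(1) by (intro nn_integral_liminf) auto
  also have "\<dots> \<le> C"
    using le by (intro order.trans[OF Liminf_le_Limsup Limsup_bounded]) auto
  finally show ?thesis .
qed

lemma integrable_duality_map_inner:
  assumes "2 \<le> p" "f \<in> Lsp M p" "g \<in> Lsp M p"
  shows "integrable M (\<lambda>x. duality_map p (f x) \<bullet> g x)"
proof (rule Bochner_Integration.integrable_bound)
  show "integrable M (\<lambda>x. norm (g x) powr p + norm (f x) powr p)" using assms by auto
  have [measurable]: "f \<in> borel_measurable M" "g \<in> borel_measurable M" using assms by auto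
  show "(\<lambda>x. duality_map p (f x) \<bullet> g x) \<in> borel_measurable M" by measurable
  have "\<bar>duality_map p (f x) \<bullet> g x\<bar> \<le> norm (g x) powr p + norm (f x) powr p" for x
    using Cauchy_Schwarz_ineq2[of "duality_map p (f x)" "g x"]
      powr_mult_le_weighted[of "norm (f x)" "norm (g x)" 1 p] assms(1)
    by (simp add: norm_duality_map)
  thus "AE x in M. norm (duality_map p (f x) \<bullet> g x) \<le> norm (norm (g x) powr p + norm (f x) powr p)"
    by (auto intro!: always_eventually order.trans[OF _ abs_ge_self])
qed

context finite_measure
begin

lemma Lsp_bounded:
  assumes "f \<in> borel_measurable M" "AE x in M. norm (f x) \<le> B" "0 \<le> p"
  shows "f \<in> Lsp M p"
proof (rule LspI_bound)
  show "integrable M (\<lambda>x. B powr p)" by simp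
  show "AE x in M. norm (f x) powr p \<le> B powr p"
    using assms(2) by eventually_elim (use assms in \<open>auto intro: powr_mono2\<close>)
qed (use assms in auto)

lemma Lsp_mono:
  assumes "f \<in> Lsp M p" "0 \<le> q" "q \<le> p"
  shows "f \<in> Lsp M q" "power_integral M q f \<le> measure M (space M) + power_integral M p f"
proof -
  have le: "norm (f x) powr q \<le> 1 + norm (f x) powr p" for x
  proof (cases "norm (f x) \<le> 1")
    case True
    hence "norm (f x) powr q \<le> 1" using assms by (intro powr_le1) auto
    thus ?thesis by (smt (verit) powr_ge_zero)
  next
    case False
    hence "norm (f x) powr q \<le> norm (f x) powr p" using assms by (intro powr_mono) auto
    thus ?thesis by simp
  qed
  show "f \<in> Lsp M q"
    by (rule LspI_bound[where g="\<lambda>x. 1 + norm (f x) powr p"]) (use assms le in auto)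
  hence "power_integral M q f \<le> (LINT x|M. 1 + norm (f x) powr p)"
    unfolding power_integral_def using assms le by (intro integral_mono) auto
  also have "\<dots> = measure M (space M) + power_integral M p f"
    unfolding power_integral_def using assms by (subst Bochner_Integration.integral_add) auto
  finally show "power_integral M q f \<le> measure M (space M) + power_integral M p f" .
qed

text \<open>Completeness by the argument of Riesz and Fischer. The geometric rate makes the L1 norms
  of the increments summable, so the telescoping series converges absolutely a.e.; Fatou's lemma
  then carries the rate over to the limit.\<close>

lemma fast_Cauchy_Lsp_limit:
  fixes f :: "nat \<Rightarrow> 'a \<Rightarrow> 'b::euclidean_space"
  assumes p: "1 \<le> p" and f: "\<And>n. f n \<in> Lsp M p"
    and cauchy: "\<And>n k. n \<le> k \<Longrightarrow> power_integral M p (\<lambda>x. f n x - f k x) \<le> ((1/2) ^ n) powr p"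
  obtains g where "g \<in> Lsp M p" "AE x in M. (\<lambda>n. f n x) \<longlonglongrightarrow> g x"
    "\<And>n. power_integral M p (\<lambda>x. f n x - g x) \<le> ((1/2) ^ n) powr p"
proof -
  have [measurable]: "f n \<in> borel_measurable M" for n using f by auto
  define d where "d n x = f (Suc n) x - f n x" for n x
  have d_meas [measurable]: "d n \<in> borel_measurable M" for n unfolding d_def by measurable
  have dL: "d n \<in> Lsp M p" for n unfolding d_def using f p by (intro Lsp_diff) auto
  define \<mu> where "\<mu> = measure M (space M)"
  have bound: "(\<integral>\<^sup>+x. ennreal (norm (d n x)) \<partial>M) \<le> ennreal ((1/2) ^ n * (\<mu> + 1))" for n
  proof -
    define \<delta> :: real where "\<delta> = (1/2) ^ n"
    have \<delta>: "\<delta> > 0" by (simp add: \<delta>_def)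
    \<comment> \<open>Takes the place of Hoelder's inequality: above the level
      \<open>\<delta>\<close> the factor \<open>norm (d n x) powr (1 - p)\<close> is at most
      \<open>\<delta> powr (1 - p)\<close>. With \<open>\<delta>\<close> equal to the rate, the
      integrals of both terms are bounded by multiples of \<open>\<delta>\<close>.\<close>
    have le: "norm (d n x) \<le> \<delta> + \<delta> powr (1 - p) * norm (d n x) powr p" for x
    proof (cases "norm (d n x) \<le> \<delta>")
      case False
      have "norm (d n x) = norm (d n x) powr (1 - p) * norm (d n x) powr p"
        using False \<delta> by (subst powr_add[symmetric]) auto
      also have "\<dots> \<le> \<delta> powr (1 - p) * norm (d n x) powr p"
        using False \<delta> p by (intro mult_right_mono powr_mono2') auto
      finally show ?thesis using \<delta> by simp
    qed (simp add: add_increasing2)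
    have int_le: "(LINT x|M. \<delta> + \<delta> powr (1 - p) * norm (d n x) powr p) \<le> (1/2) ^ n * (\<mu> + 1)"
    proof -
      have "(LINT x|M. \<delta> + \<delta> powr (1 - p) * norm (d n x) powr p)
          = \<delta> * \<mu> + \<delta> powr (1 - p) * power_integral M p (d n)"
        unfolding power_integral_def \<mu>_def using dL[of n]
        by (subst Bochner_Integration.integral_add) auto
      also have "\<dots> \<le> \<delta> * \<mu> + \<delta> powr (1 - p) * \<delta> powr p"
        using cauchy[of n "Suc n"] unfolding d_def \<delta>_def
        by (intro add_left_mono mult_left_mono) (simp_all add: power_integral_diff_commute)
      also have "\<delta> powr (1 - p) * \<delta> powr p = \<delta>" using \<delta> by (subst powr_add[symmetric]) auto
      finally show ?thesis by (simp add: \<delta>_def algebra_simps)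
    qed
    have "(\<integral>\<^sup>+x. ennreal (norm (d n x)) \<partial>M)
        \<le> (\<integral>\<^sup>+x. ennreal (\<delta> + \<delta> powr (1 - p) * norm (d n x) powr p) \<partial>M)"
      by (intro nn_integral_mono ennreal_leI le)
    also have "\<dots> = ennreal (LINT x|M. \<delta> + \<delta> powr (1 - p) * norm (d n x) powr p)"
      using dL[of n] \<delta> by (intro nn_integral_eq_integral) auto
    also have "\<dots> \<le> ennreal ((1/2) ^ n * (\<mu> + 1))" by (intro ennreal_leI int_le)
    finally show ?thesis .
  qed
  have "(\<integral>\<^sup>+x. (\<Sum>n. ennreal (norm (d n x))) \<partial>M) = (\<Sum>n. \<integral>\<^sup>+x. ennreal (norm (d n x)) \<partial>M)"
    by (intro nn_integral_suminf) auto
  also have "\<dots> \<le> (\<Sum>n. ennreal ((1/2) ^ n * (\<mu> + 1)))"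
    by (intro suminf_le bound) auto
  also have "\<dots> < \<infinity>"
  proof -
    have "summable (\<lambda>n. (1/2::real) ^ n * (\<mu> + 1))" by (intro summable_mult2 summable_geometric) auto
    thus ?thesis by (subst suminf_ennreal2) (auto simp: \<mu>_def)
  qed
  finally have "AE x in M. (\<Sum>n. ennreal (norm (d n x))) \<noteq> \<infinity>"
    by (intro nn_integral_PInf_AE) auto
  hence conv: "AE x in M. convergent (\<lambda>n. f n x)"
  proof eventually_elim
    case (elim x)
    hence "summable (\<lambda>n. norm (d n x))" by (intro summable_suminf_not_top) auto
    hence "summable (\<lambda>n. d n x)" by (rule summable_norm_cancel)
    hence "convergent (\<lambda>n. \<Sum>k<n. d k x)" by (simp add: summable_iff_convergent)
    moreover have "(\<Sum>k<n. d k x) = f n x - f 0 x" for n by (induction n) (auto simp: d_def)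
    ultimately have "convergent (\<lambda>n. (f n x - f 0 x) + f 0 x)" by (intro convergent_add convergent_const) simp
    thus ?case by simp
  qed
  \<comment> \<open>Where the sequence diverges, \<open>lim\<close> is an unspecified constant,
    which concerns a null set only.\<close>
  define g where "g x = lim (\<lambda>n. f n x)" for x
  have g_meas [measurable]: "g \<in> borel_measurable M" unfolding g_def by measurable
  have lim: "AE x in M. (\<lambda>n. f n x) \<longlonglongrightarrow> g x"
    using conv by eventually_elim (simp add: g_def convergent_LIMSEQ_iff)
  have diff: "(\<integral>\<^sup>+x. ennreal (norm (f n x - g x) powr p) \<partial>M) \<le> ennreal (((1/2) ^ n) powr p)" for n
  proof (rule nn_integral_le_of_AE_tendsto[where g="\<lambda>k x. norm (f n x - f k x) powr p"])
    show "AE x in M. (\<lambda>k. norm (f n x - f k x) powr p) \<longlonglongrightarrow> norm (f n x - g x) powr p"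
      using lim by eventually_elim (use p in \<open>auto intro!: tendsto_powr2 tendsto_intros\<close>)
    show "\<forall>\<^sub>F k in sequentially. (\<integral>\<^sup>+x. ennreal (norm (f n x - f k x) powr p) \<partial>M) \<le> ennreal (((1/2) ^ n) powr p)"
      using eventually_ge_at_top[of n]
    proof eventually_elim
      case (elim k)
      have "(\<lambda>x. f n x - f k x) \<in> Lsp M p" using f p by (intro Lsp_diff) auto
      from nn_integral_norm_powr[OF this] show ?case using cauchy[OF elim] by simp
    qed
  qed auto
  have fg: "(\<lambda>x. f n x - g x) \<in> Lsp M p" "power_integral M p (\<lambda>x. f n x - g x) \<le> ((1/2) ^ n) powr p" for n
    by (rule LspI_nn_integral[OF _ diff]; simp)+
  have "g \<in> Lsp M p" using Lsp_diff[OF _ f[of 0] fg(1)[of 0]] p by simp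
  thus thesis using lim fg(2) by (intro that) auto
qed

text \<open>A minimising sequence of \<open>power_integral M p f - \<phi> f\<close> is Cauchy by Clarkson's inequality, and
  the Euler equation of the minimiser represents \<open>\<phi>\<close>. For \<open>S = Lsp M p\<close> this is the Riesz
  representation theorem, for \<open>p = 2\<close> and \<open>\<phi>\<close> an inner product it is orthogonal projection.\<close>

lemma representation_on_closed_subspace:
  fixes S :: "('a \<Rightarrow> 'b::euclidean_space) set"
  assumes p: "2 \<le> p" and S: "S \<subseteq> Lsp M p" "(\<lambda>x. 0) \<in> S"
    and S_add: "\<And>f g. f \<in> S \<Longrightarrow> g \<in> S \<Longrightarrow> (\<lambda>x. f x + g x) \<in> S"
    and S_scale: "\<And>c f. f \<in> S \<Longrightarrow> (\<lambda>x. c *\<^sub>R f x) \<in> S"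
    and S_closed: "\<And>u f. (\<And>n. u n \<in> S) \<Longrightarrow> f \<in> Lsp M p \<Longrightarrow>
       (\<lambda>n. power_integral M p (\<lambda>x. u n x - f x)) \<longlonglongrightarrow> 0 \<Longrightarrow> f \<in> S"
    and \<phi>_add: "\<And>f g. f \<in> S \<Longrightarrow> g \<in> S \<Longrightarrow> \<phi> (\<lambda>x. f x + g x) = \<phi> f + \<phi> g"
    and \<phi>_scale: "\<And>c f. f \<in> S \<Longrightarrow> \<phi> (\<lambda>x. c *\<^sub>R f x) = c * \<phi> f"
    and \<phi>_bound: "\<And>f. f \<in> S \<Longrightarrow> \<bar>\<phi> f\<bar> \<le> C * Lnorm M p f"
  obtains f where "f \<in> S" "\<And>h. h \<in> S \<Longrightarrow> \<phi> h = p * (LINT x|M. duality_map p (f x) \<bullet> h x)"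
proof -
  define J where "J f = power_integral M p f - \<phi> f" for f
  \<comment> \<open>At least 1, so that \<open>t \<ge> C'\<close> gives
    \<open>C' * t \<le> t powr 2 \<le> t powr p\<close>; for smaller \<open>t\<close> the product is
    at most \<open>C' * C'\<close>.\<close>
  define C' where "C' = max 1 C"
  have lower: "- (C' * C') \<le> J f" if "f \<in> S" for f
  proof -
    define t where "t = Lnorm M p f"
    have t: "0 \<le> t" "power_integral M p f = t powr p"
      using p by (auto simp: t_def Lnorm_power_integral powr_powr)
    have "\<phi> f \<le> C * t" using \<phi>_bound[OF that] by (simp add: t_def)
    also have "\<dots> \<le> C' * t" using t by (intro mult_right_mono) (auto simp: C'_def)
    also have "\<dots> \<le> t powr p + C' * C'"
    proof (cases "C' \<le> t")
      case True
      hence "C' * t \<le> t powr 2" using t by (simp add: power2_eq_square mult_right_mono)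
      also have "\<dots> \<le> t powr p" using True p by (intro powr_mono) (auto simp: C'_def)
      finally show ?thesis by (simp add: add_increasing2)
    next
      case False
      hence "C' * t \<le> C' * C'" by (intro mult_left_mono) (auto simp: C'_def)
      thus ?thesis by (simp add: add_increasing)
    qed
    finally show ?thesis using t by (simp add: J_def)
  qed
  hence bdd: "bdd_below (J ` S)" by (intro bdd_belowI[where m="- (C' * C')"]) auto
  define m where "m = Inf (J ` S)"
  have m_le: "m \<le> J f" if "f \<in> S" for f unfolding m_def using bdd that by (intro cInf_lower) auto
  \<comment> \<open>The factor \<open>(1/2) powr p\<close> compensates the one half in the
    half-difference of Clarkson's inequality, so that the distances themselves come out as powers of
    1/2.\<close>
  define \<epsilon> :: "nat \<Rightarrow> real" where "\<epsilon> n = (1/2) powr p * ((1/2) ^ n) powr p" for n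
  have "\<exists>f\<in>S. J f < m + \<epsilon> n" for n
  proof -
    have "Inf (J ` S) < m + \<epsilon> n" by (simp add: m_def \<epsilon>_def)
    thus ?thesis using S(2) by (subst (asm) cInf_less_iff[OF _ bdd]) auto
  qed
  then obtain u where u: "\<And>n. u n \<in> S" "\<And>n. J (u n) < m + \<epsilon> n" by metis
  have uL: "u n \<in> Lsp M p" for n using u S by auto
  have \<epsilon>_mono: "\<epsilon> k \<le> \<epsilon> n" if "n \<le> k" for n k
    unfolding \<epsilon>_def using that p by (intro mult_left_mono powr_mono2 power_decreasing) auto
  have cauchy: "power_integral M p (\<lambda>x. u n x - u k x) \<le> ((1/2) ^ n) powr p" if nk: "n \<le> k" for n k
  proof -
    let ?a = "\<lambda>x. (1/2) *\<^sub>R (u n x + u k x)" and ?b = "\<lambda>x. (1/2) *\<^sub>R (u n x - u k x)"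
    have aS: "?a \<in> S" using u by (intro S_scale S_add)
    have aL: "?a \<in> Lsp M p" using aS S by auto
    have bL: "?b \<in> Lsp M p" using uL p by (intro Lsp_scaleR Lsp_diff) auto
    have "power_integral M p ?a + power_integral M p ?b
        = (LINT x|M. norm (?a x) powr p + norm (?b x) powr p)"
      unfolding power_integral_def using aL bL by (intro Bochner_Integration.integral_add[symmetric]) auto
    also have "\<dots> \<le> (LINT x|M. (norm (u n x) powr p + norm (u k x) powr p) / 2)"
    proof (intro integral_mono)
      show "integrable M (\<lambda>x. norm (?a x) powr p + norm (?b x) powr p)"
        using LspD(2)[OF aL] LspD(2)[OF bL] by (rule Bochner_Integration.integrable_add)
      show "integrable M (\<lambda>x. (norm (u n x) powr p + norm (u k x) powr p) / 2)"
        using LspD(2)[OF uL[of n]] LspD(2)[OF uL[of k]] by auto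
    qed (rule Clarkson_powr[OF p])
    also have "\<dots> = (power_integral M p (u n) + power_integral M p (u k)) / 2"
      unfolding power_integral_def using LspD(2)[OF uL[of n]] LspD(2)[OF uL[of k]] by simp
    \<comment> \<open>By linearity the value of \<open>\<phi>\<close> at the midpoint is the mean of
      the two values, so \<open>\<phi>\<close> cancels and only values of \<open>J\<close> remain.
      The midpoint lies in \<open>S\<close>, whence \<open>J\<close> is at least \<open>m\<close>
      there.\<close>
    finally have "power_integral M p ?b \<le> (J (u n) + J (u k)) / 2 - J ?a"
      using \<phi>_scale[OF S_add[OF u(1) u(1)], of "1/2" n k] \<phi>_add[OF u(1) u(1), of n k]
      unfolding J_def by (simp add: field_simps)
    also have "\<dots> \<le> \<epsilon> n" using u(2)[of n] u(2)[of k] \<epsilon>_mono[OF nk] m_le[OF aS] by argo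
    finally show ?thesis unfolding power_integral_scaleR \<epsilon>_def by simp
  qed
  obtain f where f: "f \<in> Lsp M p" "AE x in M. (\<lambda>n. u n x) \<longlonglongrightarrow> f x"
    "\<And>n. power_integral M p (\<lambda>x. u n x - f x) \<le> ((1/2) ^ n) powr p"
  proof -
    have "1 \<le> p" using p by simp
    from this uL cauchy show thesis by (rule fast_Cauchy_Lsp_limit) (assumption, blast intro: that)
  qed
  have half0: "(\<lambda>n. ((1/2::real) ^ n)) \<longlonglongrightarrow> 0" by (intro LIMSEQ_realpow_zero) auto
  have "(\<lambda>n. ((1/2::real) ^ n) powr p) \<longlonglongrightarrow> 0 powr p"
  proof (rule tendsto_powr2[OF half0 tendsto_const])
    show "\<forall>\<^sub>F n in sequentially. 0 \<le> (1/2::real) ^ n" by simp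
  qed (use p in simp)
  hence lim0: "(\<lambda>n. ((1/2::real) ^ n) powr p) \<longlonglongrightarrow> 0" by (simp only: powr_0)
  have fS: "f \<in> S"
  proof (rule S_closed[OF u(1) f(1)])
    show "(\<lambda>n. power_integral M p (\<lambda>x. u n x - f x)) \<longlonglongrightarrow> 0"
      by (rule tendsto_sandwich[OF always_eventually always_eventually tendsto_const lim0]) (intro allI power_integral_nonneg f(3))+
  qed
  have \<phi>_conv: "(\<lambda>n. \<phi> (u n)) \<longlonglongrightarrow> \<phi> f"
  proof -
    have \<phi>_diff: "norm (\<phi> (u n) - \<phi> f) \<le> C' * (1/2) ^ n" for n
    proof -
      have dS: "(\<lambda>x. u n x + (-1) *\<^sub>R f x) \<in> S" using u fS by (intro S_add S_scale)
      have "\<phi> (u n) - \<phi> f = \<phi> (\<lambda>x. u n x + (-1) *\<^sub>R f x)"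
        using \<phi>_add[OF u(1) S_scale[OF fS], of n "-1"] \<phi>_scale[OF fS, of "-1"] by simp
      hence "\<bar>\<phi> (u n) - \<phi> f\<bar> \<le> C * Lnorm M p (\<lambda>x. u n x - f x)"
        using \<phi>_bound[OF dS] by simp
      also have "\<dots> \<le> C' * Lnorm M p (\<lambda>x. u n x - f x)"
        by (intro mult_right_mono) (auto simp: C'_def Lnorm_def)
      also have "Lnorm M p (\<lambda>x. u n x - f x) \<le> (((1/2) ^ n) powr p) powr (1/p)"
        unfolding Lnorm_power_integral using f(3) p by (intro powr_mono2) auto
      also have "\<dots> = (1/2) ^ n" using p by (simp add: powr_powr)
      finally show ?thesis unfolding real_norm_def by (simp add: C'_def mult_left_mono)
    qed
    have "(\<lambda>n. C' * (1/2) ^ n) \<longlonglongrightarrow> C' * 0" by (intro tendsto_mult_left half0)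
    hence "(\<lambda>n. C' * (1/2) ^ n) \<longlonglongrightarrow> 0" by (simp only: mult_zero_right)
    hence "(\<lambda>n. \<phi> (u n) - \<phi> f) \<longlonglongrightarrow> 0"
      by (rule Lim_null_comparison[OF always_eventually[OF allI[OF \<phi>_diff]]])
    thus ?thesis by (rule LIM_zero_cancel)
  qed
  \<comment> \<open>Fatou's lemma gives lower semicontinuity of the power integral along the
    minimising sequence, while \<open>\<phi>\<close> converges by its norm bound.\<close>
  have "J f \<le> m"
  proof (rule field_le_epsilon)
    fix e :: real assume e: "0 < e"
    have "\<epsilon> \<longlonglongrightarrow> (1/2) powr p * 0"
      unfolding \<epsilon>_def by (intro tendsto_mult_left lim0)
    hence "eventually (\<lambda>n. \<epsilon> n < e / 2) sequentially"
      using p e by (intro order_tendstoD) auto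
    moreover have "eventually (\<lambda>n. \<phi> (u n) < \<phi> f + e / 2) sequentially"
      using \<phi>_conv e by (intro order_tendstoD) auto
    ultimately have ev: "eventually (\<lambda>n. power_integral M p (u n) \<le> m + \<phi> f + e) sequentially"
    proof eventually_elim
      case (elim n)
      then show ?case using u(2)[of n] unfolding J_def by linarith
    qed
    then obtain n where "power_integral M p (u n) \<le> m + \<phi> f + e" by (auto simp: eventually_sequentially)
    hence ge0: "0 \<le> m + \<phi> f + e" using power_integral_nonneg order.trans by blast
    have "(\<integral>\<^sup>+x. ennreal (norm (f x) powr p) \<partial>M) \<le> ennreal (m + \<phi> f + e)"
    proof (rule nn_integral_le_of_AE_tendsto[where g="\<lambda>n x. norm (u n x) powr p"])
      show "AE x in M. (\<lambda>n. norm (u n x) powr p) \<longlonglongrightarrow> norm (f x) powr p"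
        using f(2) by eventually_elim (use p in \<open>auto intro!: tendsto_powr2 tendsto_intros\<close>)
      show "\<forall>\<^sub>F n in sequentially. (\<integral>\<^sup>+x. ennreal (norm (u n x) powr p) \<partial>M) \<le> ennreal (m + \<phi> f + e)"
        using ev by eventually_elim (simp add: nn_integral_norm_powr[OF uL] ennreal_leI)
    qed (use uL in auto)
    from LspI_nn_integral(2)[OF LspD(1)[OF f(1)] this ge0] show "J f \<le> m + e" by (simp add: J_def)
  qed
  hence min: "J f \<le> J g" if "g \<in> S" for g using m_le[OF that] by simp
  have half: "\<phi> h \<le> p * (LINT x|M. duality_map p (f x) \<bullet> h x)" if h: "h \<in> S" for h
  proof -
    have hL: "h \<in> Lsp M p" using h S by auto
    \<comment> \<open>The tangent is taken at the perturbed point \<open>f + t h\<close>, not at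
      \<open>f\<close>: this bounds the increment of the power integral from above by
      \<open>t\<close> times a pairing that converges as \<open>t\<close> tends to 0.\<close>
    have step: "\<phi> h \<le> p * (LINT x|M. duality_map p (f x + t *\<^sub>R h x) \<bullet> h x)" if t: "0 < t" for t
    proof -
      let ?g = "\<lambda>x. f x + t *\<^sub>R h x"
      have gS: "?g \<in> S" using fS h by (intro S_add S_scale)
      hence gL: "?g \<in> Lsp M p" using S by auto
      have int: "integrable M (\<lambda>x. duality_map p (?g x) \<bullet> h x)"
        by (rule integrable_duality_map_inner[OF p gL hL])
      have "t * \<phi> h \<le> power_integral M p ?g - power_integral M p f"
        using min[OF gS] \<phi>_add[OF fS S_scale[OF h], of t] \<phi>_scale[OF h, of t] by (simp add: J_def)
      also have "\<dots> = (LINT x|M. norm (?g x) powr p - norm (f x) powr p)"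
        unfolding power_integral_def using LspD(2)[OF gL] f(1)
        by (intro Bochner_Integration.integral_diff[symmetric]) auto
      also have "\<dots> \<le> (LINT x|M. p * t * (duality_map p (?g x) \<bullet> h x))"
      proof (intro integral_mono)
        show "integrable M (\<lambda>x. norm (?g x) powr p - norm (f x) powr p)"
          using LspD(2)[OF gL] LspD(2)[OF f(1)] by (rule Bochner_Integration.integrable_diff)
        show "integrable M (\<lambda>x. p * t * (duality_map p (?g x) \<bullet> h x))" using int by simp
        show "norm (?g x) powr p - norm (f x) powr p \<le> p * t * (duality_map p (?g x) \<bullet> h x)" for x
          using norm_powr_ge_tangent[of p "?g x" "f x"] p by simp
      qed
      also have "\<dots> = t * (p * (LINT x|M. duality_map p (?g x) \<bullet> h x))" by simp
      finally show ?thesis using t by simp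
    qed
    have meas [measurable]: "f \<in> borel_measurable M" "h \<in> borel_measurable M" using f(1) hL by auto
    define \<tau> :: "nat \<Rightarrow> real" where "\<tau> n = inverse (real (Suc n))" for n
    have \<tau>: "0 < \<tau> n" "\<tau> n \<le> 1" for n by (auto simp: \<tau>_def field_simps)
    have \<tau>0: "\<tau> \<longlonglongrightarrow> 0" unfolding \<tau>_def by (rule LIMSEQ_inverse_real_of_nat)
    have "(\<lambda>n. LINT x|M. duality_map p (f x + \<tau> n *\<^sub>R h x) \<bullet> h x) \<longlonglongrightarrow> (LINT x|M. duality_map p (f x) \<bullet> h x)"
    proof (rule integral_dominated_convergence)
      let ?w = "\<lambda>x. 2 powr p * (norm (f x) powr p + norm (h x) powr p) + norm (h x) powr p"
      show "integrable M ?w"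
        using LspD(2)[OF f(1)] LspD(2)[OF hL] by auto
      show "AE x in M. (\<lambda>n. duality_map p (f x + \<tau> n *\<^sub>R h x) \<bullet> h x) \<longlonglongrightarrow> duality_map p (f x) \<bullet> h x"
      proof (rule always_eventually, rule allI)
        fix x
        have "(\<lambda>n. f x + \<tau> n *\<^sub>R h x) \<longlonglongrightarrow> f x + 0 *\<^sub>R h x" by (intro tendsto_intros \<tau>0)
        hence "(\<lambda>n. duality_map p (f x + \<tau> n *\<^sub>R h x)) \<longlonglongrightarrow> duality_map p (f x)"
          using p by (intro isCont_tendsto_compose[OF isCont_duality_map]) auto
        thus "(\<lambda>n. duality_map p (f x + \<tau> n *\<^sub>R h x) \<bullet> h x) \<longlonglongrightarrow> duality_map p (f x) \<bullet> h x"
          by (intro tendsto_intros)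
      qed
      fix n
      have "\<bar>duality_map p (f x + \<tau> n *\<^sub>R h x) \<bullet> h x\<bar> \<le> ?w x" for x
      proof -
        let ?g = "f x + \<tau> n *\<^sub>R h x"
        have "\<bar>duality_map p ?g \<bullet> h x\<bar> \<le> norm ?g powr (p - 1) * norm (h x)"
          using Cauchy_Schwarz_ineq2[of "duality_map p ?g" "h x"] by (simp add: norm_duality_map)
        also have "\<dots> \<le> norm (h x) powr p + norm ?g powr p"
          using powr_mult_le_weighted[of "norm ?g" "norm (h x)" 1 p] p by simp
        also have "norm ?g powr p \<le> 2 powr p * (norm (f x) powr p + norm (\<tau> n *\<^sub>R h x) powr p)"
          using p by (intro norm_add_powr_le) auto
        also have "norm (\<tau> n *\<^sub>R h x) powr p \<le> norm (h x) powr p"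
          using \<tau>[of n] p by (intro powr_mono2) (auto intro: mult_left_le_one_le)
        finally show ?thesis by simp
      qed
      thus "AE x in M. norm (duality_map p (f x + \<tau> n *\<^sub>R h x) \<bullet> h x) \<le> ?w x" by simp
    qed (intro borel_measurable_inner measurable_compose[OF _ borel_measurable_duality_map]
        borel_measurable_add borel_measurable_scaleR borel_measurable_const meas)+
    hence "(\<lambda>n. p * (LINT x|M. duality_map p (f x + \<tau> n *\<^sub>R h x) \<bullet> h x)) \<longlonglongrightarrow> p * (LINT x|M. duality_map p (f x) \<bullet> h x)"
      by (rule tendsto_mult_left)
    thus ?thesis by (rule tendsto_lowerbound) (use step \<tau>(1) in simp_all)
  qed
  \<comment> \<open>The inequality for \<open>-h\<close> is the reverse inequality for
    \<open>h\<close>.\<close>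
  have "\<phi> h = p * (LINT x|M. duality_map p (f x) \<bullet> h x)" if h: "h \<in> S" for h
    using half[OF h] half[OF S_scale[OF h, of "-1"]] \<phi>_scale[OF h, of "-1"] by simp
  thus thesis using fS that by blast
qed

end

subsection \<open>Weak compactness\<close>

lemma convergent_of_uniform_approx:
  fixes a :: "nat \<Rightarrow> real"
  assumes "\<And>e. 0 < e \<Longrightarrow> \<exists>b. convergent b \<and> (\<forall>n. \<bar>a n - b n\<bar> \<le> e)"
  shows "convergent a"
proof -
  have "Cauchy a"
  proof (rule CauchyI)
    fix e :: real assume "0 < e"
    then obtain b where b: "convergent b" "\<And>n. \<bar>a n - b n\<bar> \<le> e / 4" using assms[of "e/4"] by auto
    then obtain N where N: "\<And>m n. m \<ge> N \<Longrightarrow> n \<ge> N \<Longrightarrow> norm (b m - b n) < e / 4"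
      using CauchyD[of b "e/4"] \<open>0 < e\<close> by (auto simp: Cauchy_convergent_iff)
    have "norm (a m - a n) < e" if "m \<ge> N" "n \<ge> N" for m n
      using b(2)[of m] b(2)[of n] N[OF that] \<open>0 < e\<close> unfolding real_norm_def by linarith
    thus "\<exists>N. \<forall>m\<ge>N. \<forall>n\<ge>N. norm (a m - a n) < e" by blast
  qed
  thus ?thesis by (simp add: Cauchy_convergent_iff)
qed

lemma tendsto_of_uniform_approx:
  fixes a :: "nat \<Rightarrow> real"
  assumes "\<And>e. 0 < e \<Longrightarrow> \<exists>b \<beta>. b \<longlonglongrightarrow> \<beta> \<and> (\<forall>n. \<bar>a n - b n\<bar> \<le> e) \<and> \<bar>\<alpha> - \<beta>\<bar> \<le> e"
  shows "a \<longlonglongrightarrow> \<alpha>"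
proof (rule LIMSEQ_I)
  fix e :: real assume "0 < e"
  then obtain b \<beta> where b: "b \<longlonglongrightarrow> \<beta>" "\<And>n. \<bar>a n - b n\<bar> \<le> e / 4" "\<bar>\<alpha> - \<beta>\<bar> \<le> e / 4"
    using assms[of "e/4"] by auto
  then obtain N where N: "\<And>n. n \<ge> N \<Longrightarrow> norm (b n - \<beta>) < e / 4"
    using LIMSEQ_D[of b \<beta> "e/4"] \<open>0 < e\<close> by auto
  have "norm (a n - \<alpha>) < e" if "n \<ge> N" for n
    using b(2)[of n] b(3) N[OF that] \<open>0 < e\<close> unfolding real_norm_def by linarith
  thus "\<exists>N. \<forall>n\<ge>N. norm (a n - \<alpha>) < e" by blast
qed

text \<open>The weighted Young inequality under the integral. The two-term form serves estimates in
  which \<open>power_integral M p g\<close> is bounded and \<open>power_integral M p f\<close> is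
  small.\<close>

lemma duality_pairing_bound:
  assumes "2 \<le> p" "f \<in> Lsp M p" "g \<in> Lsp M p" "0 < \<delta>" "\<delta> \<le> 1"
  shows "\<bar>LINT x|M. duality_map p (f x) \<bullet> g x\<bar> \<le> \<delta> * power_integral M p g + power_integral M p f / \<delta>"
proof -
  have int: "integrable M (\<lambda>x. \<delta> * norm (g x) powr p + norm (f x) powr p / \<delta>)"
    using LspD(2)[OF assms(2)] LspD(2)[OF assms(3)] by auto
  have "\<bar>LINT x|M. duality_map p (f x) \<bullet> g x\<bar> \<le> (LINT x|M. \<bar>duality_map p (f x) \<bullet> g x\<bar>)"
    by (rule integral_abs_bound)
  also have "\<dots> \<le> (LINT x|M. \<delta> * norm (g x) powr p + norm (f x) powr p / \<delta>)"
  proof (intro integral_mono integrable_abs integrable_duality_map_inner assms int)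
    fix x
    have "\<bar>duality_map p (f x) \<bullet> g x\<bar> \<le> norm (f x) powr (p - 1) * norm (g x)"
      using Cauchy_Schwarz_ineq2[of "duality_map p (f x)" "g x"] by (simp add: norm_duality_map)
    also have "\<dots> \<le> \<delta> * norm (g x) powr p + norm (f x) powr p / \<delta>"
      using assms by (intro powr_mult_le_weighted) auto
    finally show "\<bar>duality_map p (f x) \<bullet> g x\<bar> \<le> \<delta> * norm (g x) powr p + norm (f x) powr p / \<delta>" .
  qed
  also have "\<dots> = \<delta> * power_integral M p g + power_integral M p f / \<delta>"
    unfolding power_integral_def using LspD(2)[OF assms(2)] LspD(2)[OF assms(3)]
    by (subst Bochner_Integration.integral_add) auto
  finally show ?thesis .
qed

lemmas integrable_inner_L2 = integrable_duality_map_inner[of 2, simplified]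
lemmas inner_L2_bound = duality_pairing_bound[of 2, simplified]

lemma power_integral_2: "power_integral M 2 f = (LINT x|M. f x \<bullet> f x)"
  by (simp add: power_integral_def dot_square_norm)

text \<open>A scaling argument: on the unit sphere the right-hand side of the assumption is constant.\<close>

lemma Lnorm_bound_of_homogeneous:
  assumes "0 < p" "\<And>c. \<phi> (\<lambda>x. c *\<^sub>R f x) = c * \<phi> f"
    and bound: "\<And>c. \<bar>\<phi> (\<lambda>x. c *\<^sub>R f x)\<bar> \<le> K * (1 + power_integral M p (\<lambda>x. c *\<^sub>R f x))"
  shows "\<bar>\<phi> f\<bar> \<le> 2 * K * Lnorm M p f"
proof -
  define t where "t = Lnorm M p f"
  have t: "0 \<le> t" "power_integral M p f = t powr p"
    using assms(1) by (auto simp: t_def Lnorm_power_integral powr_powr)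
  have b: "\<bar>c\<bar> * \<bar>\<phi> f\<bar> \<le> K * (1 + (\<bar>c\<bar> * t) powr p)" for c
    using bound[of c] t(1) by (simp add: assms(2) abs_mult power_integral_scaleR t(2) powr_mult)
  have "\<bar>\<phi> f\<bar> \<le> 2 * K * t"
  proof (cases "t = 0")
    case True
    have "\<phi> f = 0"
    proof (rule ccontr)
      assume "\<phi> f \<noteq> 0"
      with b[of "(\<bar>K\<bar> + 1) / \<bar>\<phi> f\<bar>"] True show False by (simp add: abs_mult)
    qed
    thus ?thesis using True by simp
  next
    case False
    with b[of "1 / t"] t show ?thesis by (simp add: field_simps)
  qed
  thus ?thesis by (simp add: t_def)
qed

context finite_measure
begin

text \<open>The representing function, \<open>p\<close> times \<open>duality_map p\<close> of
  \<open>f\<close>, has the conjugate exponent; parametrising it by \<open>f\<close> keeps the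
  statement inside \<open>Lsp M p\<close>. The subspace is the whole space, so its closedness is
  trivial.\<close>

lemma Ldual_representation:
  fixes \<phi> :: "('a \<Rightarrow> 'b::euclidean_space) \<Rightarrow> real"
  assumes "2 \<le> p" "\<phi> \<in> Ldual M p"
  obtains f where "f \<in> Lsp M p"
    "\<And>h. h \<in> Lsp M p \<Longrightarrow> \<phi> h = p * (LINT x|M. duality_map p (f x) \<bullet> h x)"
proof -
  from assms(2) obtain C where C: "\<And>f. f \<in> Lsp M p \<Longrightarrow> \<bar>\<phi> f\<bar> \<le> C * Lnorm M p f"
    unfolding Ldual_def by blast
  show thesis
  proof (rule representation_on_closed_subspace[of p "Lsp M p" \<phi> C])
    show "\<phi> (\<lambda>x. f x + g x) = \<phi> f + \<phi> g" if "f \<in> Lsp M p" "g \<in> Lsp M p" for f g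
      using assms(2) that by (auto simp: Ldual_def)
    show "\<phi> (\<lambda>x. c *\<^sub>R f x) = c * \<phi> f" if "f \<in> Lsp M p" for c f
      using assms(2) that by (auto simp: Ldual_def)
    show "(\<lambda>x. f x + g x) \<in> Lsp M p" if "f \<in> Lsp M p" "g \<in> Lsp M p" for f g :: "'a \<Rightarrow> 'b"
      using that assms(1) by (intro Lsp_add) auto
  qed (use assms(1) C Lsp_scaleR that in \<open>simp_all\<close>)
qed

text \<open>Only the pairings with the countably many \<open>u m\<close> are made convergent by a
  diagonal choice. The test functions with convergent pairings form a closed subspace
  \<open>S\<close> containing every \<open>u m\<close>, so a general \<open>g\<close> may be
  replaced by its orthogonal projection onto \<open>S\<close> without changing any pairing with the
  sequence. The limit functional is then represented by a function.\<close>

lemma L2_bounded_weakly_convergent_subseq: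
  fixes u :: "nat \<Rightarrow> 'a \<Rightarrow> 'b::euclidean_space"
  assumes u: "\<And>n. u n \<in> Lsp M 2" and B: "\<And>n. power_integral M 2 (u n) \<le> B"
  obtains \<mu> w where "strict_mono (\<mu> :: nat \<Rightarrow> nat)" "w \<in> Lsp M 2"
    "\<And>g. g \<in> Lsp M 2 \<Longrightarrow> (\<lambda>n. LINT x|M. u (\<mu> n) x \<bullet> g x) \<longlonglongrightarrow> (LINT x|M. w x \<bullet> g x)"
proof -
  have B0: "0 \<le> B" using B[of 0] power_integral_nonneg order.trans by blast
  define F where "F n m = (LINT x|M. u n x \<bullet> u m x)" for n m
  have F_bound: "norm (F n m) \<le> B + B" for n m
    using inner_L2_bound[OF u u, of 1 n m] B[of n] B[of m] by (simp add: F_def)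
  \<comment> \<open>A diagonal subsequence: the rows of the Gram matrix \<open>F\<close> are
    uniformly bounded functions on the countable set of column indices.\<close>
  have "\<exists>\<mu>. strict_mono \<mu> \<and> (\<forall>m. \<exists>l. (\<lambda>n. F (\<mu> n) m) \<longlonglongrightarrow> l)"
    by (rule function_convergent_subsequence[of UNIV F "B + B"]) (simp, rule F_bound, blast)
  then obtain \<mu> where \<mu>: "strict_mono \<mu>"
    and conv: "\<And>m. \<exists>l. (\<lambda>n. F (\<mu> n) m) \<longlonglongrightarrow> l"
    by blast
  define P where "P n g = (LINT x|M. u (\<mu> n) x \<bullet> g x)" for n g
  have P_add: "P n (\<lambda>x. f x + g x) = P n f + P n g" if "f \<in> Lsp M 2" "g \<in> Lsp M 2" for n f g
    unfolding P_def inner_add_right using that u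
    by (intro Bochner_Integration.integral_add integrable_inner_L2) auto
  have P_scale: "P n (\<lambda>x. c *\<^sub>R f x) = c * P n f" for n c f
    unfolding P_def by simp
  have P_bound: "\<bar>P n g\<bar> \<le> \<delta> * B + power_integral M 2 g / \<delta>"
    if "g \<in> Lsp M 2" "0 < \<delta>" "\<delta> \<le> 1" for n g \<delta>
  proof -
    have "\<bar>P n g\<bar> \<le> \<delta> * power_integral M 2 (u (\<mu> n)) + power_integral M 2 g / \<delta>"
      using inner_L2_bound[OF that(1) u that(2,3), of "\<mu> n"] unfolding P_def by (simp add: inner_commute)
    also have "\<dots> \<le> \<delta> * B + power_integral M 2 g / \<delta>"
      using B that by (intro add_right_mono mult_left_mono) auto
    finally show ?thesis .
  qed
  define S where "S = {g \<in> Lsp M 2. convergent (\<lambda>n. P n g)}"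
  have S_sub: "S \<subseteq> Lsp M 2" by (auto simp: S_def)
  have uS: "u m \<in> S" for m using conv[of m] u by (auto simp: S_def P_def F_def convergent_def)
  have S_add: "(\<lambda>x. f x + g x) \<in> S" if "f \<in> S" "g \<in> S" for f g
    using that by (auto simp: S_def P_add intro!: Lsp_add convergent_add)
  have S_scale: "(\<lambda>x. c *\<^sub>R f x) \<in> S" if "f \<in> S" for c f
    using that convergent_mult[OF convergent_const[of c], of "\<lambda>n. P n f"]
    by (auto simp: S_def P_scale intro!: Lsp_scaleR)
  have zero_S: "(\<lambda>x. 0) \<in> S" using S_scale[OF uS[of 0], of 0] by simp
  have S_closed: "f \<in> S" if g: "\<And>k. g k \<in> S" and f: "f \<in> Lsp M 2"
    and lim: "(\<lambda>k. power_integral M 2 (\<lambda>x. g k x - f x)) \<longlonglongrightarrow> 0" for g f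
  proof -
    have "convergent (\<lambda>n. P n f)"
    proof (rule convergent_of_uniform_approx)
      fix e :: real assume e: "0 < e"
      \<comment> \<open>Chosen before \<open>k\<close>: it limits the contribution of the bounded
        sequence to \<open>e / 2\<close>, and \<open>k\<close> is then taken so large that the error
        divided by \<open>\<delta>\<close> is at most \<open>e / 2\<close> too.\<close>
      define \<delta> where "\<delta> = min 1 (e / (2 * (B + 1)))"
      have \<delta>: "0 < \<delta>" "\<delta> \<le> 1" using e B0 by (auto simp: \<delta>_def)
      have "\<delta> \<le> e / (2 * (B + 1))" by (simp add: \<delta>_def)
      hence "\<delta> * (2 * (B + 1)) \<le> e" using B0 by (subst (asm) pos_le_divide_eq) auto
      hence \<delta>B: "\<delta> * B \<le> e / 2" using \<delta>(1) by (simp add: algebra_simps)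
      from lim have "eventually (\<lambda>k. power_integral M 2 (\<lambda>x. g k x - f x) < \<delta> * (e / 2)) sequentially"
        using \<delta> e by (intro order_tendstoD) auto
      then obtain k where k: "power_integral M 2 (\<lambda>x. g k x - f x) < \<delta> * (e / 2)"
        by (auto simp: eventually_sequentially)
      have gk: "g k \<in> Lsp M 2" using g S_sub by auto
      have "\<bar>P n f - P n (g k)\<bar> \<le> e" for n
      proof -
        have dL: "(\<lambda>x. g k x - f x) \<in> Lsp M 2" using gk f by (intro Lsp_diff) auto
        have "P n (g k) = P n f + P n (\<lambda>x. g k x - f x)"
          using P_add[OF f dL, of n] by simp
        moreover have "power_integral M 2 (\<lambda>x. g k x - f x) / \<delta> \<le> e / 2"
          using k \<delta> by (simp add: field_simps)
        ultimately show ?thesis using P_bound[OF dL \<delta>, of n] \<delta>B by linarith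
      qed
      moreover have "convergent (\<lambda>n. P n (g k))" using g by (auto simp: S_def)
      ultimately show "\<exists>b. convergent b \<and> (\<forall>n. \<bar>P n f - b n\<bar> \<le> e)" by blast
    qed
    thus ?thesis using f by (simp add: S_def)
  qed
  have all: "convergent (\<lambda>n. P n g)" if g: "g \<in> Lsp M 2" for g
  proof -
    define K where "K = 2 * (1 + power_integral M 2 g)"
    \<comment> \<open>The factor 2 is the \<open>p\<close> of the representation formula for
      \<open>p = 2\<close>; it cancels when \<open>g\<close> is compared with its projection
      \<open>s\<close>.\<close>
    have bnd: "\<bar>2 * (LINT x|M. g x \<bullet> f x)\<bar> \<le> 2 * K * Lnorm M 2 f" if "f \<in> S" for f
    proof (rule Lnorm_bound_of_homogeneous[where \<phi>="\<lambda>f. 2 * (LINT x|M. g x \<bullet> f x)"])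
      fix c
      have "(\<lambda>x. c *\<^sub>R f x) \<in> Lsp M 2" using that S_sub by (auto intro: Lsp_scaleR)
      from inner_L2_bound[OF g this, of 1]
      have "\<bar>2 * (LINT x|M. g x \<bullet> c *\<^sub>R f x)\<bar>
          \<le> 2 * (power_integral M 2 (\<lambda>x. c *\<^sub>R f x) + power_integral M 2 g)" by simp
      also have "\<dots> \<le> K * (1 + power_integral M 2 (\<lambda>x. c *\<^sub>R f x))"
        unfolding K_def by (simp add: algebra_simps)
      finally show "\<bar>2 * (LINT x|M. g x \<bullet> c *\<^sub>R f x)\<bar> \<le> K * (1 + power_integral M 2 (\<lambda>x. c *\<^sub>R f x))" .
    qed auto
    obtain s where s: "s \<in> S" "\<And>h. h \<in> S \<Longrightarrow> 2 * (LINT x|M. g x \<bullet> h x) = 2 * (LINT x|M. duality_map 2 (s x) \<bullet> h x)"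
    proof (rule representation_on_closed_subspace[of 2 S "\<lambda>h. 2 * (LINT x|M. g x \<bullet> h x)" "2 * K"])
      show "2 * (LINT x|M. g x \<bullet> (f x + f' x)) = 2 * (LINT x|M. g x \<bullet> f x) + 2 * (LINT x|M. g x \<bullet> f' x)"
        if "f \<in> S" "f' \<in> S" for f f'
        using integrable_inner_L2[OF g subsetD[OF S_sub that(1)]] integrable_inner_L2[OF g subsetD[OF S_sub that(2)]]
        by (simp add: inner_add_right)
      show "f \<in> S" if "\<And>n. v n \<in> S" "f \<in> Lsp M 2"
        "(\<lambda>n. power_integral M 2 (\<lambda>x. v n x - f x)) \<longlonglongrightarrow> 0" for v f
        using that by (rule S_closed)
    qed (use S_sub zero_S S_add S_scale bnd that in simp_all)
    have "P n g = P n s" for n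
      using s(2)[OF uS[of "\<mu> n"]] unfolding P_def by (simp add: inner_commute)
    thus ?thesis using s(1) by (simp add: S_def)
  qed
  define \<psi> where "\<psi> g = lim (\<lambda>n. P n g)" for g
  have \<psi>: "(\<lambda>n. P n g) \<longlonglongrightarrow> \<psi> g" if "g \<in> Lsp M 2" for g
    using all[OF that] by (simp add: \<psi>_def convergent_LIMSEQ_iff)
  have \<psi>_add: "\<psi> (\<lambda>x. f x + g x) = \<psi> f + \<psi> g" if "f \<in> Lsp M 2" "g \<in> Lsp M 2" for f g
    using LIMSEQ_unique[OF \<psi>[OF Lsp_add[OF _ that]]] tendsto_add[OF \<psi>[OF that(1)] \<psi>[OF that(2)]]
    by (simp add: P_add[OF that])
  have \<psi>_scale: "\<psi> (\<lambda>x. c *\<^sub>R f x) = c * \<psi> f" if "f \<in> Lsp M 2" for c f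
    using LIMSEQ_unique[OF \<psi>[OF Lsp_scaleR[OF that]]] tendsto_mult_left[OF \<psi>[OF that]]
    by (simp add: P_scale)
  have \<psi>_bound: "\<bar>\<psi> f\<bar> \<le> 2 * (B + 1) * Lnorm M 2 f" if "f \<in> Lsp M 2" for f
  proof (rule Lnorm_bound_of_homogeneous)
    fix c
    have cL: "(\<lambda>x. c *\<^sub>R f x) \<in> Lsp M 2" using that by (rule Lsp_scaleR)
    have "\<bar>P n (\<lambda>x. c *\<^sub>R f x)\<bar> \<le> (B + 1) * (1 + power_integral M 2 (\<lambda>x. c *\<^sub>R f x))" for n
    proof -
      have "\<bar>P n (\<lambda>x. c *\<^sub>R f x)\<bar> \<le> B + power_integral M 2 (\<lambda>x. c *\<^sub>R f x)"
        using P_bound[OF cL, of 1 n] by simp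
      also have "\<dots> \<le> (B + 1) * (1 + power_integral M 2 (\<lambda>x. c *\<^sub>R f x))"
        using B0 mult_nonneg_nonneg[OF B0 power_integral_nonneg[of M 2 "\<lambda>x. c *\<^sub>R f x"]]
        by (simp add: distrib_left distrib_right)
      finally show ?thesis .
    qed
    thus "\<bar>\<psi> (\<lambda>x. c *\<^sub>R f x)\<bar> \<le> (B + 1) * (1 + power_integral M 2 (\<lambda>x. c *\<^sub>R f x))"
      by (intro tendsto_upperbound[OF tendsto_rabs[OF \<psi>[OF cL]]] always_eventually) auto
  qed (use \<psi>_scale[OF that] in auto)
  have "\<psi> \<in> Ldual M 2"
    unfolding Ldual_def mem_Collect_eq
    by (intro conjI allI ballI exI[of _ "2 * (B + 1)"] \<psi>_add \<psi>_scale \<psi>_bound)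
  then obtain w where w: "w \<in> Lsp M 2"
    "\<And>h. h \<in> Lsp M 2 \<Longrightarrow> \<psi> h = 2 * (LINT x|M. duality_map 2 (w x) \<bullet> h x)"
    by (rule Ldual_representation[OF order.refl]) blast
  show thesis
  \<comment> \<open>The same factor \<open>p = 2\<close> makes the weak limit twice the function
    \<open>w\<close> obtained from the representation.\<close>
  proof (rule that[OF \<mu> Lsp_scaleR[OF w(1), of 2]])
    fix g :: "'a \<Rightarrow> 'b" assume g: "g \<in> Lsp M 2"
    show "(\<lambda>n. LINT x|M. u (\<mu> n) x \<bullet> g x) \<longlonglongrightarrow> (LINT x|M. (2 *\<^sub>R w x) \<bullet> g x)"
      using \<psi>[OF g] w(2)[OF g] unfolding P_def by simp
  qed
qed

text \<open>A functional is represented through some \<open>f\<close>; cutting \<open>f\<close> off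
  at height \<open>k\<close> leaves a bounded test function and a tail. The tail has small power
  integral, and its pairing with the sequence is small uniformly in \<open>n\<close> because of the
  bound \<open>B\<close>.\<close>

lemma weakly_converges_of_bounded_tests:
  fixes u :: "nat \<Rightarrow> 'a \<Rightarrow> 'b::euclidean_space"
  assumes p: "2 \<le> p" and u: "\<And>n. u n \<in> Lsp M p" and B: "\<And>n. power_integral M p (u n) \<le> B"
    and w: "w \<in> Lsp M p"
    and lim: "\<And>g K. g \<in> borel_measurable M \<Longrightarrow> (\<And>x. norm (g x) \<le> K) \<Longrightarrow>
      (\<lambda>n. LINT x|M. u n x \<bullet> g x) \<longlonglongrightarrow> (LINT x|M. w x \<bullet> g x)"
  shows "weakly_converges M p u w"
proof -
  have "(\<lambda>n. \<phi> (u n)) \<longlonglongrightarrow> \<phi> w" if dual: "\<phi> \<in> Ldual M p" for \<phi>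
  proof -
    obtain f where f: "f \<in> Lsp M p" and
      \<phi>: "\<And>h. h \<in> Lsp M p \<Longrightarrow> \<phi> h = p * (LINT x|M. duality_map p (f x) \<bullet> h x)"
      by (rule Ldual_representation[OF p dual]) blast
    have [measurable]: "f \<in> borel_measurable M" using f by auto
    define lo hi where "lo k x = (if norm (f x) \<le> real k then f x else 0)"
      and "hi k x = (if norm (f x) \<le> real k then 0 else f x)" for k x
    have [measurable]: "lo k \<in> borel_measurable M" "hi k \<in> borel_measurable M" for k
      unfolding lo_def hi_def by measurable
    have lohi: "lo k \<in> Lsp M p" "hi k \<in> Lsp M p" for k
      by (rule LspI_bound[OF _ LspD(2)[OF f]]; simp add: lo_def hi_def)+
    \<comment> \<open>Although \<open>duality_map\<close> is nonlinear it splits here, since at each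
      point one of the two parts is 0 and \<open>duality_map p 0 = 0\<close>.\<close>
    have split: "duality_map p (f x) = duality_map p (lo k x) + duality_map p (hi k x)" for k x
      by (simp add: lo_def hi_def duality_map_def)
    have hi0: "(\<lambda>k. power_integral M p (hi k)) \<longlonglongrightarrow> 0"
    proof -
      have "(\<lambda>k. LINT x|M. norm (hi k x) powr p) \<longlonglongrightarrow> (LINT x|M. 0)"
      proof (rule integral_dominated_convergence[OF _ _ LspD(2)[OF f]])
        show "AE x in M. (\<lambda>k. norm (hi k x) powr p) \<longlonglongrightarrow> 0"
        proof (rule always_eventually, rule allI)
          fix x
          have "eventually (\<lambda>k. norm (f x) \<le> real k) sequentially"
            using eventually_ge_at_top[of "nat \<lceil>norm (f x)\<rceil>"] by eventually_elim linarith
          hence "eventually (\<lambda>k. norm (hi k x) powr p = 0) sequentially"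
            by eventually_elim (simp add: hi_def)
          thus "(\<lambda>k. norm (hi k x) powr p) \<longlonglongrightarrow> 0" by (rule tendsto_eventually)
        qed
      qed (auto simp: hi_def)
      thus ?thesis by (simp add: power_integral_def)
    qed
    show ?thesis
    proof (rule tendsto_of_uniform_approx)
      fix e :: real assume e: "0 < e"
      \<comment> \<open>Covers the limit as well, so that one estimate serves both
        \<open>u n\<close> and \<open>w\<close>.\<close>
      define B' where "B' = max B (power_integral M p w)"
      have B': "0 \<le> B'" "power_integral M p w \<le> B'" "\<And>n. power_integral M p (u n) \<le> B'"
        using B by (auto simp: B'_def le_max_iff_disj)
      define \<delta> where "\<delta> = min 1 (e / (2 * p) / (B' + 1))"
      have \<delta>: "0 < \<delta>" "\<delta> \<le> 1" using e B'(1) p by (auto simp: \<delta>_def)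
      have "\<delta> \<le> e / (2 * p) / (B' + 1)" by (simp add: \<delta>_def)
      hence "\<delta> * (B' + 1) \<le> e / (2 * p)" using B'(1) by (subst (asm) pos_le_divide_eq) auto
      hence \<delta>B: "\<delta> * B' \<le> e / (2 * p)" using \<delta>(1) by (simp add: distrib_left)
      from hi0 have "eventually (\<lambda>k. power_integral M p (hi k) < \<delta> * (e / (2 * p))) sequentially"
        using \<delta> e p by (intro order_tendstoD) auto
      then obtain k where k: "power_integral M p (hi k) < \<delta> * (e / (2 * p))"
        by (auto simp: eventually_sequentially)
      define L where "L h = p * (LINT x|M. h x \<bullet> duality_map p (lo k x))" for h :: "'a \<Rightarrow> 'b"
      have close: "\<bar>\<phi> h - L h\<bar> \<le> e" if h: "h \<in> Lsp M p" "power_integral M p h \<le> B'" for h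
      proof -
        have "\<phi> h = p * ((LINT x|M. duality_map p (lo k x) \<bullet> h x) + (LINT x|M. duality_map p (hi k x) \<bullet> h x))"
          unfolding \<phi>[OF h(1)] split[of _ k] inner_add_left using integrable_duality_map_inner[OF p lohi(1) h(1), of k] integrable_duality_map_inner[OF p lohi(2) h(1), of k]
          by simp
        hence "\<bar>\<phi> h - L h\<bar> = p * \<bar>LINT x|M. duality_map p (hi k x) \<bullet> h x\<bar>"
          unfolding L_def using p by (simp add: inner_commute distrib_left abs_mult)
        also have "\<dots> \<le> p * (\<delta> * power_integral M p h + power_integral M p (hi k) / \<delta>)"
          using p \<delta> lohi h by (intro mult_left_mono duality_pairing_bound) auto
        also have "\<dots> \<le> p * (e / (2 * p) + e / (2 * p))"
        proof (intro mult_left_mono add_mono)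
          show "\<delta> * power_integral M p h \<le> e / (2 * p)"
            using mult_left_mono[OF h(2), of \<delta>] \<delta> \<delta>B by linarith
          show "power_integral M p (hi k) / \<delta> \<le> e / (2 * p)"
            using k \<delta> by (simp add: divide_le_eq mult.commute)
        qed (use p in simp)
        also have "\<dots> = e" using p by (simp add: field_simps)
        finally show ?thesis .
      qed
      have "norm (duality_map p (lo k x)) \<le> real k powr (p - 1)" for x
        unfolding norm_duality_map using p by (intro powr_mono2) (auto simp: lo_def)
      hence "(\<lambda>n. L (u n)) \<longlonglongrightarrow> L w"
        unfolding L_def by (intro tendsto_mult_left lim) measurable
      thus "\<exists>b \<beta>. b \<longlonglongrightarrow> \<beta> \<and> (\<forall>n. \<bar>\<phi> (u n) - b n\<bar> \<le> e) \<and> \<bar>\<phi> w - \<beta>\<bar> \<le> e"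
        using close[OF u B'(3)] close[OF w B'(2)] by blast
    qed
  qed
  thus ?thesis using u w by (simp add: weakly_converges_def)
qed

end

subsection \<open>Weak limits and convexity\<close>

lemma le_linear_of_increments_le:
  fixes a :: "nat \<Rightarrow> real"
  assumes "a 0 = 0" "\<And>K. a (Suc K) \<le> a K + C"
  shows "a K \<le> real K * C"
proof (induction K)
  case (Suc K)
  then show ?case using assms(2)[of K] by (simp add: algebra_simps)
qed (use assms in simp)

context finite_measure
begin

text \<open>The Banach--Saks theorem: a subsequence is chosen whose members are nearly orthogonal to
  their predecessors.\<close>

lemma L2_weak_limit_cesaro_AE:
  fixes u :: "nat \<Rightarrow> 'a \<Rightarrow> 'b::euclidean_space"
  assumes u: "\<And>n. u n \<in> Lsp M 2" and B: "\<And>n. power_integral M 2 (u n) \<le> B"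
    and w: "w \<in> Lsp M 2"
    and lim: "\<And>g. g \<in> Lsp M 2 \<Longrightarrow> (\<lambda>n. LINT x|M. u n x \<bullet> g x) \<longlonglongrightarrow> (LINT x|M. w x \<bullet> g x)"
  obtains \<sigma> r :: "nat \<Rightarrow> nat" where
    "AE x in M. (\<lambda>n. \<Sum>k<Suc (r n). (1 / real (Suc (r n))) *\<^sub>R u (\<sigma> k) x) \<longlonglongrightarrow> w x"
proof -
  define d where "d n x = u n x - w x" for n x
  have dL: "d n \<in> Lsp M 2" for n unfolding d_def using u w by (intro Lsp_diff) auto
  have int_uu: "integrable M (\<lambda>x. f x \<bullet> g x)" if "f \<in> Lsp M 2" "g \<in> Lsp M 2" for f g :: "'a \<Rightarrow> 'b"
    using that by (rule integrable_inner_L2)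
  have dlim: "(\<lambda>n. LINT x|M. g x \<bullet> d n x) \<longlonglongrightarrow> 0" if g: "g \<in> Lsp M 2" for g
  proof -
    have "(LINT x|M. g x \<bullet> d n x) = (LINT x|M. u n x \<bullet> g x) - (LINT x|M. w x \<bullet> g x)" for n
      unfolding d_def inner_diff_right using int_uu[OF g u, of n] int_uu[OF g w]
      by (simp add: inner_commute)
    thus ?thesis using tendsto_diff[OF lim[OF g] tendsto_const[of "LINT x|M. w x \<bullet> g x"]] by simp
  qed
  define D where "D = 4 * (B + power_integral M 2 w)"
  have dB: "power_integral M 2 (d n) \<le> D" for n
  proof -
    have "power_integral M 2 (\<lambda>x. u n x + (-1) *\<^sub>R w x)
        \<le> 2 powr 2 * (power_integral M 2 (u n) + power_integral M 2 (\<lambda>x. (-1) *\<^sub>R w x))"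
      by (rule power_integral_add_le[OF _ u Lsp_scaleR[OF w]]) simp
    hence "power_integral M 2 (d n) \<le> 4 * (power_integral M 2 (u n) + power_integral M 2 w)"
      unfolding power_integral_scaleR by (simp add: d_def[abs_def])
    also have "\<dots> \<le> D" using B[of n] by (simp add: D_def)
    finally show ?thesis .
  qed
  define I where "I f g = (LINT x|M. f x \<bullet> g x)" for f g :: "'a \<Rightarrow> 'b"
  \<comment> \<open>The recursive choice sees only the preceding index, so near-orthogonality is
    demanded against all \<open>d m\<close> with \<open>m \<le> \<sigma> n\<close>, which includes
    every index chosen before.\<close>
  have "\<exists>\<sigma>. \<forall>n. True \<and> (\<sigma> n < \<sigma> (Suc n) \<and> (\<forall>m\<le>\<sigma> n. \<bar>I (d m) (d (\<sigma> (Suc n)))\<bar> \<le> 1 / real (Suc n)))"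
  proof (rule dependent_nat_choice)
    fix x n :: nat
    have "eventually (\<lambda>y. \<bar>I (d m) (d y)\<bar> \<le> 1 / real (Suc n)) sequentially" for m
      using tendsto_rabs[OF dlim[OF dL, of m]]
      by (intro eventually_mono[OF order_tendstoD(2)[of _ _ _ "1 / real (Suc n)"]]) (auto simp: I_def)
    hence "eventually (\<lambda>y. \<forall>m\<in>{..x}. \<bar>I (d m) (d y)\<bar> \<le> 1 / real (Suc n)) sequentially"
      by (intro eventually_ball_finite) auto
    hence "eventually (\<lambda>y. x < y \<and> (\<forall>m\<in>{..x}. \<bar>I (d m) (d y)\<bar> \<le> 1 / real (Suc n))) sequentially"
      using eventually_gt_at_top by (rule eventually_conj[rotated])
    thus "\<exists>y. True \<and> x < y \<and> (\<forall>m\<le>x. \<bar>I (d m) (d y)\<bar> \<le> 1 / real (Suc n))"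
      by (auto simp: eventually_sequentially)
  qed simp
  then obtain \<sigma> where \<sigma>: "\<And>n. \<sigma> n < \<sigma> (Suc n)"
    "\<And>n m. m \<le> \<sigma> n \<Longrightarrow> \<bar>I (d m) (d (\<sigma> (Suc n)))\<bar> \<le> 1 / real (Suc n)" by auto
  have mono: "strict_mono \<sigma>" using \<sigma>(1) by (simp add: strict_mono_Suc_iff)
  have small: "\<bar>I (d (\<sigma> j)) (d (\<sigma> K))\<bar> * real K \<le> 1" if jK: "j < K" for j K
  proof -
    obtain n where n: "K = Suc n" using jK by (cases K) auto
    have "\<sigma> j \<le> \<sigma> n" using mono jK n by (simp add: strict_mono_less_eq)
    from \<sigma>(2)[OF this] show ?thesis unfolding n by (simp add: field_simps)
  qed
  define s where "s K x = (\<Sum>k<K. d (\<sigma> k) x)" for K x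
  have sL: "s K \<in> Lsp M 2" for K
  proof (induction K)
    case (Suc K)
    then show ?case using Lsp_add[OF _ Suc dL, of "\<sigma> K"] by (simp add: s_def)
  qed (simp add: s_def)
  \<comment> \<open>Expanding the square, the cross term consists of \<open>K\<close> pairings of
    size at most \<open>1 / K\<close>, hence contributes at most 2 after doubling; the new square
    adds at most \<open>D\<close>. Linear growth makes the squared norms of the means decay like
    \<open>1 / n\<close>.\<close>
  have s_bound: "power_integral M 2 (s K) \<le> real K * (D + 2)" for K
  proof (rule le_linear_of_increments_le)
    fix K
    have cross: "I (s K) (d (\<sigma> K)) = (\<Sum>j<K. I (d (\<sigma> j)) (d (\<sigma> K)))"
      unfolding I_def s_def inner_sum_left by (intro Bochner_Integration.integral_sum int_uu dL)
    have "2 * I (s K) (d (\<sigma> K)) \<le> 2"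
    proof (cases "K = 0")
      case False
      have "(\<Sum>j<K. I (d (\<sigma> j)) (d (\<sigma> K))) \<le> (\<Sum>j<K. 1 / real K)"
      proof (intro sum_mono)
        fix j assume "j \<in> {..<K}"
        with small[of j K] False show "I (d (\<sigma> j)) (d (\<sigma> K)) \<le> 1 / real K"
          by (simp add: pos_le_divide_eq) (smt (verit) mult_right_mono of_nat_0_le_iff)
      qed
      thus ?thesis using False by (simp add: cross)
    qed (simp add: I_def s_def)
    moreover have "power_integral M 2 (s (Suc K)) = power_integral M 2 (s K) + 2 * I (s K) (d (\<sigma> K)) + power_integral M 2 (d (\<sigma> K))"
    proof -
      have "power_integral M 2 (s (Suc K)) =
          (LINT x|M. (s K x \<bullet> s K x + 2 * (s K x \<bullet> d (\<sigma> K) x)) + d (\<sigma> K) x \<bullet> d (\<sigma> K) x)"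
        unfolding power_integral_2 by (simp add: s_def inner_add inner_commute algebra_simps)
      also have "\<dots> = power_integral M 2 (s K) + 2 * I (s K) (d (\<sigma> K)) + power_integral M 2 (d (\<sigma> K))"
        unfolding power_integral_2 I_def using int_uu[OF sL sL, of K K] int_uu[OF sL dL, of K "\<sigma> K"] int_uu[OF dL dL, of "\<sigma> K" "\<sigma> K"]
        by simp
      finally show ?thesis .
    qed
    ultimately show "power_integral M 2 (s (Suc K)) \<le> power_integral M 2 (s K) + (D + 2)"
      using dB[of "\<sigma> K"] by simp
  qed (simp add: s_def power_integral_def)
  define m where "m n x = (1 / real (Suc n)) *\<^sub>R s (Suc n) x" for n x
  have mL: "m n \<in> Lsp M 2" for n unfolding m_def by (intro Lsp_scaleR sL)
  have m_bound: "norm (power_integral M 2 (m n)) \<le> (D + 2) * inverse (real (Suc n))" for n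
  proof -
    have "power_integral M 2 (m n) = (1 / real (Suc n))\<^sup>2 * power_integral M 2 (s (Suc n))"
      unfolding m_def power_integral_scaleR by simp
    also have "\<dots> \<le> (1 / real (Suc n))\<^sup>2 * (real (Suc n) * (D + 2))"
      by (intro mult_left_mono s_bound) auto
    also have "\<dots> = (D + 2) * inverse (real (Suc n))" by (simp add: power2_eq_square divide_simps del: of_nat_Suc)
    finally show ?thesis by (simp del: of_nat_Suc)
  qed
  have "(\<lambda>n. (D + 2) * inverse (real (Suc n))) \<longlonglongrightarrow> 0"
    using tendsto_mult_left[OF LIMSEQ_inverse_real_of_nat, of "D + 2"] by simp
  hence "(\<lambda>n. power_integral M 2 (m n)) \<longlonglongrightarrow> 0"
    by (rule Lim_null_comparison[OF always_eventually[OF allI[OF m_bound]]])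
  hence "(\<lambda>n. LINT x|M. norm (norm (m n x) powr 2)) \<longlonglongrightarrow> 0" by (simp add: power_integral_def)
  \<comment> \<open>Mean-square convergence gives convergence a.e. only along a subsequence
    \<open>r\<close> of the means; each of these still averages all of \<open>\<sigma> 0\<close>,
    ..., \<open>\<sigma> (r n)\<close>.\<close>
  from tendsto_L1_AE_subseq[OF LspD(2)[OF mL] this]
  obtain r where r: "strict_mono (r :: nat \<Rightarrow> nat)" "AE x in M. (\<lambda>n. norm (m (r n) x) powr 2) \<longlonglongrightarrow> 0"
    by auto
  have "AE x in M. (\<lambda>n. \<Sum>k<Suc (r n). (1 / real (Suc (r n))) *\<^sub>R u (\<sigma> k) x) \<longlonglongrightarrow> w x"
    using r(2)
  proof eventually_elim
    case (elim x)
    from tendsto_real_sqrt[OF elim] have "(\<lambda>n. m (r n) x) \<longlonglongrightarrow> 0"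
      by (subst tendsto_norm_zero_iff[symmetric]) simp
    hence "(\<lambda>n. m (r n) x + w x) \<longlonglongrightarrow> 0 + w x" by (intro tendsto_add tendsto_const)
    moreover have "m n x + w x = (\<Sum>k<Suc n. (1 / real (Suc n)) *\<^sub>R u (\<sigma> k) x)" for n
    proof -
      have "(\<Sum>k<Suc n. (1 / real (Suc n)) *\<^sub>R u (\<sigma> k) x)
          = (1 / real (Suc n)) *\<^sub>R (\<Sum>k<Suc n. d (\<sigma> k) x + w x)"
        unfolding d_def by (simp only: scaleR_sum_right diff_add_cancel)
      also have "(\<Sum>k<Suc n. d (\<sigma> k) x + w x) = s (Suc n) x + real (Suc n) *\<^sub>R w x"
        by (simp only: sum.distrib s_def sum_constant_scaleR card_lessThan)
      finally show ?thesis by (simp add: m_def scaleR_add_right del: of_nat_Suc)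
    qed
    ultimately show ?case by (simp only: add_0)
  qed
  thus thesis by (rule that)
qed

text \<open>The Cesaro means are convex combinations of points of \<open>S x\<close> and converge
  a.e. The set may vary with \<open>x\<close>, as the distortion condition does through
  \<open>M x\<close>.\<close>

lemma weak_limit_in_closed_convex:
  fixes u :: "nat \<Rightarrow> 'a \<Rightarrow> 'b::euclidean_space"
  assumes u: "\<And>n. u n \<in> Lsp M 2" and B: "\<And>n. power_integral M 2 (u n) \<le> B"
    and w: "w \<in> Lsp M 2"
    and lim: "\<And>g. g \<in> Lsp M 2 \<Longrightarrow> (\<lambda>n. LINT x|M. u n x \<bullet> g x) \<longlonglongrightarrow> (LINT x|M. w x \<bullet> g x)"
    and S: "\<And>x. closed (S x)" "\<And>x. convex (S x)" "\<And>n. AE x in M. u n x \<in> S x"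
  shows "AE x in M. w x \<in> S x"
proof -
  obtain \<sigma> r where ae: "AE x in M. (\<lambda>n. \<Sum>k<Suc (r n). (1 / real (Suc (r n))) *\<^sub>R u (\<sigma> k) x) \<longlonglongrightarrow> w x"
    using L2_weak_limit_cesaro_AE[OF u B w lim] by blast
  have "AE x in M. \<forall>n. u n x \<in> S x" using S(3) by (simp add: AE_all_countable)
  with ae show ?thesis
  proof eventually_elim
    case (elim x)
    show ?case
    proof (rule Lim_in_closed_set[OF S(1) _ _ elim(1)])
      show "\<forall>\<^sub>F n in sequentially. (\<Sum>k<Suc (r n). (1 / real (Suc (r n))) *\<^sub>R u (\<sigma> k) x) \<in> S x"
        using elim(2) by (intro always_eventually allI convex_sum S) (auto simp del: of_nat_Suc)
    qed simp
  qed
qed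

text \<open>Jensen's inequality bounds \<open>f x\<close> of a mean by the mean of the values, whose
  integrals stay below \<open>L\<close>, and Fatou's lemma passes to the limit. As \<open>L\<close>
  bounds every member, a bound by the lower limit is obtained by applying this to tails.\<close>

lemma weak_lsc_convex_integral:
  fixes u :: "nat \<Rightarrow> 'a \<Rightarrow> 'b::euclidean_space" and f :: "'a \<Rightarrow> 'b \<Rightarrow> real"
  assumes u: "\<And>n. u n \<in> Lsp M 2" and B: "\<And>n. power_integral M 2 (u n) \<le> B"
    and w: "w \<in> Lsp M 2"
    and lim: "\<And>g. g \<in> Lsp M 2 \<Longrightarrow> (\<lambda>n. LINT x|M. u n x \<bullet> g x) \<longlonglongrightarrow> (LINT x|M. w x \<bullet> g x)"
    and S: "closed S" "\<And>n. AE x in M. u n x \<in> S"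
    and f: "\<And>x. convex_on S (f x)" "\<And>x. continuous_on S (f x)" "\<And>x y. 0 \<le> f x y"
      "\<And>n. (\<lambda>x. f x (u n x)) \<in> borel_measurable M"
    and L: "\<And>n. (\<integral>\<^sup>+x. ennreal (f x (u n x)) \<partial>M) \<le> L"
  shows "(\<integral>\<^sup>+x. ennreal (f x (w x)) \<partial>M) \<le> L"
proof -
  obtain \<sigma> r where ae: "AE x in M. (\<lambda>n. \<Sum>k<Suc (r n). (1 / real (Suc (r n))) *\<^sub>R u (\<sigma> k) x) \<longlonglongrightarrow> w x"
    using L2_weak_limit_cesaro_AE[OF u B w lim] by blast
  have uS: "AE x in M. \<forall>n. u n x \<in> S" using S(2) by (simp add: AE_all_countable)
  have convS: "convex S" using f(1) by (rule convex_on_imp_convex)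
  \<comment> \<open>Continuity of \<open>f x\<close> is assumed on \<open>S\<close> only, so the
    limit has to lie in \<open>S\<close> before \<open>f x\<close> can be followed along the
    means.\<close>
  have wS: "AE x in M. w x \<in> S"
    by (rule weak_limit_in_closed_convex[OF u B w lim, of "\<lambda>_. S"]) (use S convS in auto)
  define h where "h n x = (\<Sum>k<Suc n. (1 / real (Suc n)) * f x (u (\<sigma> k) x))" for n x
  have [measurable]: "h n \<in> borel_measurable M" for n
    unfolding h_def by (intro borel_measurable_sum borel_measurable_times f(4)) auto
  have h_int: "(\<integral>\<^sup>+x. ennreal (h n x) \<partial>M) \<le> L" for n
  proof -
    define c where "c = ennreal (1 / real (Suc n))"
    have h_sum: "ennreal (h n x) = (\<Sum>k<Suc n. c * ennreal (f x (u (\<sigma> k) x)))" for x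
    proof -
      have "(\<Sum>k<Suc n. c * ennreal (f x (u (\<sigma> k) x))) = (\<Sum>k<Suc n. ennreal (1 / real (Suc n) * f x (u (\<sigma> k) x)))"
        unfolding c_def by (intro sum.cong refl ennreal_mult[symmetric] f(3)) simp
      also have "\<dots> = ennreal (h n x)"
        unfolding h_def by (intro sum_ennreal mult_nonneg_nonneg f(3)) simp
      finally show ?thesis by (rule sym)
    qed
    have "(\<integral>\<^sup>+x. ennreal (h n x) \<partial>M) = (\<integral>\<^sup>+x. (\<Sum>k<Suc n. c * ennreal (f x (u (\<sigma> k) x))) \<partial>M)"
      by (simp only: h_sum)
    also have "\<dots> = (\<Sum>k<Suc n. \<integral>\<^sup>+x. c * ennreal (f x (u (\<sigma> k) x)) \<partial>M)"
      using f(4) by (intro nn_integral_sum) measurable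
    also have "\<dots> = (\<Sum>k<Suc n. c * (\<integral>\<^sup>+x. ennreal (f x (u (\<sigma> k) x)) \<partial>M))"
      using f(4) by (intro sum.cong refl nn_integral_cmult) measurable
    also have "\<dots> \<le> (\<Sum>k<Suc n. c * L)" by (intro sum_mono mult_left_mono L) auto
    also have "\<dots> = (of_nat (Suc n) * c) * L" by (simp only: sum_constant card_lessThan mult.assoc)
    also have "of_nat (Suc n) * c = 1"
      unfolding c_def by (simp add: ennreal_of_nat_eq_real_of_nat ennreal_mult[symmetric] del: of_nat_Suc)
    finally show ?thesis by simp
  qed
  have "(\<integral>\<^sup>+x. ennreal (f x (w x)) \<partial>M) \<le> (\<integral>\<^sup>+x. liminf (\<lambda>n. ennreal (h (r n) x)) \<partial>M)"
  proof (rule nn_integral_mono_AE, use ae uS wS in eventually_elim)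
    case (elim x)
    let ?m = "\<lambda>n. \<Sum>k<Suc (r n). (1 / real (Suc (r n))) *\<^sub>R u (\<sigma> k) x"
    have mS: "?m n \<in> S" for n
      using elim(2) by (intro convex_sum convS) (auto simp del: of_nat_Suc)
    have "(\<lambda>n. f x (?m n)) \<longlonglongrightarrow> f x (w x)"
      by (rule continuous_on_tendsto_compose[OF f(2) elim(1) elim(3)]) (use mS in auto)
    hence "ennreal (f x (w x)) = liminf (\<lambda>n. ennreal (f x (?m n)))"
      by (intro lim_imp_Liminf[symmetric] tendsto_ennrealI) auto
    also have "\<dots> \<le> liminf (\<lambda>n. ennreal (h (r n) x))"
    proof (intro Liminf_mono always_eventually allI ennreal_leI)
      fix n
      show "f x (?m n) \<le> h (r n) x"
        unfolding h_def using elim(2)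
        by (intro convex_on_sum[OF _ _ f(1)]) (auto simp del: of_nat_Suc)
    qed
    finally show ?case .
  qed
  also have "\<dots> \<le> liminf (\<lambda>n. \<integral>\<^sup>+x. ennreal (h (r n) x) \<partial>M)"
    by (intro nn_integral_liminf) measurable
  also have "\<dots> \<le> L"
    using h_int by (intro order.trans[OF Liminf_le_Limsup Limsup_bounded]) auto
  finally show ?thesis .
qed

end

subsection \<open>Norms, vector fields and the torus\<close>

text \<open>Equivalence of norms in finite dimension, which links \<open>Nv\<close> and
  \<open>Nm\<close> to the Euclidean norm in \<open>Lsp\<close>. The upper bound yields Lipschitz
  continuity, and the lower constant is the minimum of \<open>N\<close> over the compact unit
  sphere.\<close>

lemma is_norm_bounds:
  fixes N :: "'a::euclidean_space \<Rightarrow> real"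
  assumes "is_norm N"
  obtains k K where "0 < k" "0 < K" "\<And>x. k * norm x \<le> N x" "\<And>x. N x \<le> K * norm x" "continuous_on UNIV N"
proof -
  have N: "\<And>x. 0 \<le> N x" "\<And>x. N x = 0 \<longleftrightarrow> x = 0" "\<And>c x. N (c *\<^sub>R x) = \<bar>c\<bar> * N x"
    "\<And>x y. N (x + y) \<le> N x + N y"
    using assms by (auto simp: is_norm_def)
  have N0: "N 0 = 0" using N(2) by blast
  define K where "K = (\<Sum>b\<in>Basis. N b) + 1"
  have K: "0 < K" using N(1) by (auto simp: K_def intro!: add_nonneg_pos sum_nonneg)
  have upper: "N x \<le> K * norm x" for x
  proof -
    have sub: "N (\<Sum>b\<in>A. (x \<bullet> b) *\<^sub>R b) \<le> (\<Sum>b\<in>A. N ((x \<bullet> b) *\<^sub>R b))" if "finite A" for A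
      using that by (induction A rule: finite_induct) (auto simp: N0 intro: order.trans[OF N(4)])
    have "N x = N (\<Sum>b\<in>Basis. (x \<bullet> b) *\<^sub>R b)" by (simp add: euclidean_representation)
    also have "\<dots> \<le> (\<Sum>b\<in>Basis. \<bar>x \<bullet> b\<bar> * N b)" using sub[of Basis] by (simp add: N(3))
    also have "\<dots> \<le> (\<Sum>b\<in>Basis. norm x * N b)"
      by (intro sum_mono mult_right_mono Basis_le_norm N(1))
    also have "\<dots> = norm x * (\<Sum>b\<in>Basis. N b)" by (simp add: sum_distrib_left)
    also have "\<dots> \<le> norm x * K" by (intro mult_left_mono) (auto simp: K_def)
    finally show ?thesis by (simp add: mult.commute)
  qed
  have diff: "\<bar>N x - N y\<bar> \<le> K * norm (x - y)" for x y
    using N(4)[of "x - y" y] N(4)[of "y - x" x] upper[of "x - y"] upper[of "y - x"]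
    by (simp add: norm_minus_commute)
  have cont: "continuous_on UNIV N"
  proof (intro continuous_at_imp_continuous_on ballI)
    fix x :: 'a
    have "((\<lambda>y. K * norm (y - x)) \<longlongrightarrow> K * norm (x - x)) (at x)" by (intro tendsto_intros)
    hence "((\<lambda>y. K * norm (y - x)) \<longlongrightarrow> 0) (at x)" by simp
    hence "((\<lambda>y. N y - N x) \<longlongrightarrow> 0) (at x)"
      by (rule Lim_null_comparison[rotated]) (use diff in simp)
    thus "isCont N x" unfolding isCont_def by (rule LIM_zero_cancel)
  qed
  have "\<exists>k>0. \<forall>x. k * norm x \<le> N x"
  proof -
    obtain b :: 'a where "b \<in> Basis" using nonempty_Basis by blast
    hence False: "sphere (0::'a) 1 \<noteq> {}" by (auto intro!: exI[of _ b])
    obtain z where z: "z \<in> sphere 0 1" "\<And>y. y \<in> sphere 0 1 \<Longrightarrow> N z \<le> N y"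
      using continuous_attains_inf[OF compact_sphere False continuous_on_subset[OF cont subset_UNIV]] by blast
    have pos: "0 < N z" using z(1) N(1)[of z] N(2)[of z] by (cases "N z = 0") auto
    have "N z * norm x \<le> N x" for x
    proof (cases "x = 0")
      case False
      have "N z \<le> N ((1 / norm x) *\<^sub>R x)" using False by (intro z(2)) simp
      also have "\<dots> = N x / norm x" by (simp add: N(3))
      finally show ?thesis using False by (simp add: field_simps)
    qed (simp add: N0)
    thus ?thesis using pos by blast
  qed
  thus thesis using K upper cont that by blast
qed

lemma is_norm_convex_on:
  assumes "is_norm N"
  shows "convex_on UNIV N"
proof (rule convex_onI)
  have N: "\<And>c x. N (c *\<^sub>R x) = \<bar>c\<bar> * N x" "\<And>x y. N (x + y) \<le> N x + N y"
    using assms by (auto simp: is_norm_def)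
  fix t :: real and x y assume "0 < t" "t < 1"
  thus "N ((1 - t) *\<^sub>R x + t *\<^sub>R y) \<le> (1 - t) * N x + t * N y"
    using N(2)[of "(1 - t) *\<^sub>R x" "t *\<^sub>R y"] by (simp add: N(1))
qed simp

lemma is_norm_convex_on_powr:
  assumes "is_norm N" "1 \<le> p"
  shows "convex_on UNIV (\<lambda>x. N x powr p)"
  using assms
  by (intro convex_on_compose_mono[where g="\<lambda>t. t powr p" and N=N]
      convex_on_powr_nonneg mono_on_powr_nonneg is_norm_convex_on) (auto simp: is_norm_def)

lemma is_norm_convex_on_power:
  assumes "is_norm N" "0 < k"
  shows "convex_on UNIV (\<lambda>x. N x ^ k)"
proof -
  have "N x powr real k = N x ^ k" for x
    using assms by (simp add: powr_realpow' is_norm_def)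
  thus ?thesis using is_norm_convex_on_powr[of N "real k"] assms by simp
qed

lemma is_norm_norm: "is_norm norm"
  by (simp add: is_norm_def norm_triangle_ineq)

lemma convex_on_compose_affine:
  assumes "convex_on C g" "convex S" "\<And>x. x \<in> S \<Longrightarrow> T x \<in> C"
    and affine: "\<And>t x y. T ((1 - t) *\<^sub>R x + t *\<^sub>R y) = (1 - t) *\<^sub>R T x + t *\<^sub>R T y"
  shows "convex_on S (\<lambda>x. g (T x))"
proof (rule convex_onI)
  fix t :: real and x y assume "0 < t" "t < 1" "x \<in> S" "y \<in> S"
  thus "g (T ((1 - t) *\<^sub>R x + t *\<^sub>R y)) \<le> (1 - t) * g (T x) + t * g (T y)"
    unfolding affine by (intro convex_onD[OF assms(1)] assms(3)) auto
qed (rule assms(2))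

text \<open>The entries are polynomials in the entries of the matrix; this serves the measurability
  of \<open>cof (F0 x)\<close>.\<close>

lemma continuous_on_cof: "continuous_on UNIV (cof :: real^'n^'n \<Rightarrow> _)"
proof -
  have row: "continuous_on UNIV (\<lambda>A::real^'n^'n. if k = i then axis a 1 else A $ k)" for k i a :: 'n
    by (cases "k = i") (auto intro!: continuous_intros)
  show ?thesis unfolding cof_def det_def
    by (auto intro!: continuous_intros row)
qed

text \<open>The norm on a product type is Euclidean, so squares add. This makes the whole state one
  element of L2.\<close>

lemma Lsp_2_Pair:
  assumes "f \<in> Lsp M 2" "g \<in> Lsp M 2"
  shows "(\<lambda>x. (f x, g x)) \<in> Lsp M 2"
    "power_integral M 2 (\<lambda>x. (f x, g x)) = power_integral M 2 f + power_integral M 2 g"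
proof -
  have sq: "norm (f x, g x) powr 2 = norm (f x) powr 2 + norm (g x) powr 2" for x
    by (simp add: norm_Pair)
  show "(\<lambda>x. (f x, g x)) \<in> Lsp M 2"
    using assms by (auto simp: Lsp_def sq simp del: powr_numeral intro!: borel_measurable_Pair)
  show "power_integral M 2 (\<lambda>x. (f x, g x)) = power_integral M 2 f + power_integral M 2 g"
    unfolding power_integral_def sq using LspD(2)[OF assms(1)] LspD(2)[OF assms(2)]
    by (rule Bochner_Integration.integral_add)
qed

lemma Lsp_compose_contraction:
  assumes "f \<in> Lsp M p" "T \<in> borel_measurable borel" "\<And>y. norm (T y) \<le> norm y" "0 \<le> p"
  shows "(\<lambda>x. T (f x)) \<in> Lsp M p"
proof (rule LspI_bound[OF _ LspD(2)[OF assms(1)]])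
  show "(\<lambda>x. T (f x)) \<in> borel_measurable M"
    by (rule measurable_compose[OF LspD(1)[OF assms(1)] assms(2)])
  show "AE x in M. norm (T (f x)) powr p \<le> norm (f x) powr p"
    using assms(3,4) by (intro always_eventually allI powr_mono2) auto
qed

lemma Lsp_sum:
  assumes "0 \<le> p" "\<And>i. i \<in> I \<Longrightarrow> f i \<in> Lsp M p"
  shows "(\<lambda>x. \<Sum>i\<in>I. f i x) \<in> Lsp M p"
  using assms(2) by (induction I rule: infinite_finite_induct) (auto intro: Lsp_add[OF assms(1)])

lemma Lsp_bounded_scaleR:
  assumes f: "f \<in> Lsp M p" and \<theta>: "\<theta> \<in> borel_measurable M" "AE x in M. \<bar>\<theta> x\<bar> \<le> B" and "0 \<le> p"
  shows "(\<lambda>x. \<theta> x *\<^sub>R f x) \<in> Lsp M p"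
proof (rule LspI_bound)
  show "integrable M (\<lambda>x. B powr p * norm (f x) powr p)" using f by auto
  show "AE x in M. norm (\<theta> x *\<^sub>R f x) powr p \<le> B powr p * norm (f x) powr p"
    using \<theta>(2) by eventually_elim (use assms(4) in \<open>auto simp: powr_mult intro!: mult_right_mono powr_mono2\<close>)
  show "(\<lambda>x. \<theta> x *\<^sub>R f x) \<in> borel_measurable M" using f \<theta>(1) by auto
qed

lemma Lsp_vec_nth:
  fixes f :: "'a \<Rightarrow> 'b::euclidean_space ^ 'n"
  assumes "f \<in> Lsp M p" "0 \<le> p"
  shows "(\<lambda>x. f x $ i) \<in> Lsp M p"
  using assms by (intro Lsp_compose_contraction[where T="\<lambda>y. y $ i"] borel_measurable_continuous_onI)
    (auto intro!: continuous_intros Finite_Cartesian_Product.norm_nth_le)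

lemma Lsp_vecI:
  fixes f :: "'a \<Rightarrow> real ^ 'n"
  assumes "\<And>i. (\<lambda>x. f x $ i) \<in> Lsp M p" "0 \<le> p"
  shows "f \<in> Lsp M p"
proof -
  have "(\<lambda>x. \<Sum>i\<in>UNIV. f x $ i *\<^sub>R (axis i 1 :: real ^ 'n)) \<in> Lsp M p"
  proof (intro Lsp_sum assms(2))
    fix i
    show "(\<lambda>x. f x $ i *\<^sub>R (axis i 1 :: real ^ 'n)) \<in> Lsp M p"
      by (rule LspI_bound[OF _ LspD(2)[OF assms(1)[of i]]])
        (use assms(1)[of i] in \<open>auto simp: norm_axis_1\<close>)
  qed
  also have "(\<lambda>x. \<Sum>i\<in>UNIV. f x $ i *\<^sub>R axis i 1) = f"
    by (rule ext) (simp only: scalar_mult_eq_scaleR[symmetric] basis_expansion)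
  finally show ?thesis .
qed

lemma ext_integral_cong_AE:
  assumes "AE x in M. f x = g x"
  shows "ext_integral M f = ext_integral M g"
proof -
  have "(\<integral>\<^sup>+x. ennreal (f x) \<partial>M) = (\<integral>\<^sup>+x. ennreal (g x) \<partial>M)"
    by (rule nn_integral_cong_AE) (use assms in \<open>auto elim: eventually_mono\<close>)
  moreover have "(\<integral>\<^sup>+x. ennreal (- f x) \<partial>M) = (\<integral>\<^sup>+x. ennreal (- g x) \<partial>M)"
    by (rule nn_integral_cong_AE) (use assms in \<open>auto elim: eventually_mono\<close>)
  ultimately show ?thesis by (simp add: ext_integral_def)
qed

lemma ext_integral_eq_integral:
  assumes "integrable M f"
  shows "ext_integral M f = ereal (LINT x|M. f x)"
proof -
  have "(\<integral>\<^sup>+x. ennreal (f x) \<partial>M) \<noteq> \<infinity>" "(\<integral>\<^sup>+x. ennreal (- f x) \<partial>M) \<noteq> \<infinity>"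
    using assms by (auto simp: real_integrable_def)
  moreover have "enn2ereal a - enn2ereal b = ereal (enn2real a - enn2real b)" if "a \<noteq> \<infinity>" "b \<noteq> \<infinity>" for a b
    using that by (cases a; cases b) auto
  ultimately show ?thesis
    unfolding ext_integral_def real_lebesgue_integral_def[OF assms] by blast
qed

lemma space_torus: "space (torus l) = cbox 0 l"
  by (simp add: torus_def space_restrict_space)

lemma finite_measure_torus: "finite_measure (torus l)"
  unfolding torus_def by (rule finite_measure_lebesgue_on) simp

lemma continuous_measurable_bounded_on_torus:
  fixes f :: "real^3 \<Rightarrow> real"
  assumes "continuous_on UNIV f"
  obtains B where "f \<in> borel_measurable (torus l)" "AE x in torus l. \<bar>f x\<bar> \<le> B"
proof -
  have "f \<in> borel_measurable (torus l)"
    unfolding torus_def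
    by (intro measurable_restrict_space1 measurable_completion borel_measurable_continuous_onI)
       (use assms in \<open>simp add: borel_measurable_continuous_onI\<close>)
  moreover have "bounded (f ` cbox 0 l)"
    by (intro compact_imp_bounded compact_continuous_image continuous_on_subset[OF assms]) auto
  then obtain B where "\<And>x. x \<in> cbox 0 l \<Longrightarrow> \<bar>f x\<bar> \<le> B" by (auto simp: bounded_iff)
  hence "AE x in torus l. \<bar>f x\<bar> \<le> B" by (intro AE_I2) (simp add: space_torus)
  ultimately show thesis by (rule that)
qed

lemma continuous_on_test_function:
  assumes "\<theta> \<in> test_functions l"
  shows "continuous_on UNIV \<theta>" "continuous_on UNIV (pd a \<theta>)"
proof -
  have "foldr pd as \<theta> differentiable_on UNIV" for as
    using assms by (simp add: test_functions_def smooth_def)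
  from this[of "[]"] this[of "[a]"] show "continuous_on UNIV \<theta>" "continuous_on UNIV (pd a \<theta>)"
    by (auto intro: differentiable_imp_continuous_on)
qed

subsection \<open>The polyconvex energy\<close>

context finite_measure
begin

text \<open>The common shape of the three constraints: the left-hand side tests \<open>f n\<close>
  with \<open>\<theta>\<close> times a constant vector \<open>e\<close> that selects an entry, the
  right-hand side tests \<open>v n\<close> with a fixed field. Weak convergence takes both sides to
  the limit.\<close>

lemma integral_constraint_weak_limit:
  fixes f :: "nat \<Rightarrow> 'a \<Rightarrow> 'b::euclidean_space" and v :: "nat \<Rightarrow> 'a \<Rightarrow> 'c::euclidean_space"
  assumes L2: "\<And>n. f n \<in> Lsp M 2" "f' \<in> Lsp M 2" "f0 \<in> Lsp M 2" "g \<in> Lsp M 2"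
    and \<theta>: "\<theta> \<in> borel_measurable M" "AE x in M. \<bar>\<theta> x\<bar> \<le> B"
    and f_lim: "\<And>g. g \<in> Lsp M 2 \<Longrightarrow> (\<lambda>n. LINT x|M. f n x \<bullet> g x) \<longlonglongrightarrow> (LINT x|M. f' x \<bullet> g x)"
    and v_lim: "\<And>g. g \<in> Lsp M 2 \<Longrightarrow> (\<lambda>n. LINT x|M. v n x \<bullet> g x) \<longlonglongrightarrow> (LINT x|M. v' x \<bullet> g x)"
    and eq: "\<And>n. (LINT x|M. \<theta> x * (1/h * (f n x \<bullet> e - f0 x \<bullet> e))) = - (LINT x|M. v n x \<bullet> g x)"
  shows "(LINT x|M. \<theta> x * (1/h * (f' x \<bullet> e - f0 x \<bullet> e))) = - (LINT x|M. v' x \<bullet> g x)"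
proof -
  have test: "(\<lambda>x. \<theta> x *\<^sub>R e) \<in> Lsp M 2"
    by (intro Lsp_bounded_scaleR[OF _ \<theta>] Lsp_bounded[where B="norm e"]) auto
  have lhs: "(LINT x|M. \<theta> x * (1/h * (k x \<bullet> e - f0 x \<bullet> e)))
      = 1/h * ((LINT x|M. k x \<bullet> (\<theta> x *\<^sub>R e)) - (LINT x|M. f0 x \<bullet> (\<theta> x *\<^sub>R e)))"
    if k: "k \<in> Lsp M 2" for k
  proof -
    have "(LINT x|M. \<theta> x * (1/h * (k x \<bullet> e - f0 x \<bullet> e)))
        = (LINT x|M. 1/h * (k x \<bullet> (\<theta> x *\<^sub>R e) - f0 x \<bullet> (\<theta> x *\<^sub>R e)))"
      by (intro Bochner_Integration.integral_cong) (auto simp: algebra_simps)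
    also have "\<dots> = 1/h * (LINT x|M. k x \<bullet> (\<theta> x *\<^sub>R e) - f0 x \<bullet> (\<theta> x *\<^sub>R e))"
      by (rule integral_mult_right_zero)
    also have "(LINT x|M. k x \<bullet> (\<theta> x *\<^sub>R e) - f0 x \<bullet> (\<theta> x *\<^sub>R e))
        = (LINT x|M. k x \<bullet> (\<theta> x *\<^sub>R e)) - (LINT x|M. f0 x \<bullet> (\<theta> x *\<^sub>R e))"
      by (intro Bochner_Integration.integral_diff integrable_inner_L2 k L2(3) test)
    finally show ?thesis .
  qed
  have "(\<lambda>n. 1/h * ((LINT x|M. f n x \<bullet> (\<theta> x *\<^sub>R e)) - (LINT x|M. f0 x \<bullet> (\<theta> x *\<^sub>R e))))
      \<longlonglongrightarrow> 1/h * ((LINT x|M. f' x \<bullet> (\<theta> x *\<^sub>R e)) - (LINT x|M. f0 x \<bullet> (\<theta> x *\<^sub>R e)))"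
    by (intro tendsto_mult_left tendsto_diff tendsto_const f_lim test)
  hence "(\<lambda>n. - (LINT x|M. v n x \<bullet> g x)) \<longlonglongrightarrow> (LINT x|M. \<theta> x * (1/h * (f' x \<bullet> e - f0 x \<bullet> e)))"
    by (simp only: lhs[OF L2(1), symmetric] lhs[OF L2(2), symmetric] eq)
  moreover have "(\<lambda>n. - (LINT x|M. v n x \<bullet> g x)) \<longlonglongrightarrow> - (LINT x|M. v' x \<bullet> g x)"
    by (intro tendsto_minus v_lim L2(4))
  ultimately show ?thesis by (rule LIMSEQ_unique)
qed

end

type_synonym state_value = "(real^3) \<times> (real^3^3) \<times> (real^3^3) \<times> real"

text \<open>Two-sided growth ties the energy to the Lebesgue spaces: the lower bound yields a priori
  estimates, the upper bound makes the functional finite at every state of these spaces with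
  \<open>w \<ge> 0\<close>.\<close>

locale polyconvex_energy =
  fixes Nv :: "real^3 \<Rightarrow> real" and Nm :: "real^3^3 \<Rightarrow> real"
    and G :: "(real^3^3) \<times> (real^3^3) \<times> real \<Rightarrow> real" and C1 C2 c p q r :: real
  assumes Nv: "is_norm Nv" and Nm: "is_norm Nm"
    and exponents: "2 \<le> p" "2 \<le> q" "2 \<le> r"
    and convex: "convex_on half_space G" and continuous: "continuous_on half_space G"
    and C1_pos: "0 < C1" and c_pos: "0 < c"
    and coercive: "\<And>F Z w. 0 \<le> w \<Longrightarrow> C1 * (Nm F powr p + Nm Z powr q + w powr r) + C2 \<le> G (F, Z, w)"
    and growth: "\<And>F Z w. 0 \<le> w \<Longrightarrow> G (F, Z, w) \<le> c * (Nm F powr p + Nm Z powr q + w powr r + 1)"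
begin

text \<open>The integrand of the functional, shifted by \<open>C2\<close> to be nonnegative and extended from
  \<open>half_space\<close> to negative \<open>w\<close> to be continuous everywhere.\<close>

definition energy_density :: "real^3 \<Rightarrow> state_value \<Rightarrow> real" where
  "energy_density a U = 1/2 * Nv (fst U - a) ^ 2 +
     G (fst (snd U), fst (snd (snd U)), max 0 (snd (snd (snd U)))) - C2"

lemma energy_density_nonneg: "0 \<le> energy_density a U"
proof -
  have "0 \<le> C1 * (Nm (fst (snd U)) powr p + Nm (fst (snd (snd U))) powr q + max 0 (snd (snd (snd U))) powr r)"
    using C1_pos by (intro mult_nonneg_nonneg add_nonneg_nonneg) auto
  moreover have "0 \<le> 1/2 * Nv (fst U - a) ^ 2" by simp
  ultimately show ?thesis
    using coercive[of "max 0 (snd (snd (snd U)))" "fst (snd U)" "fst (snd (snd U))"]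
    unfolding energy_density_def by linarith
qed

text \<open>Joint continuity gives measurability when the reference velocity \<open>v0 x\<close>
  varies with \<open>x\<close>.\<close>

lemma continuous_on_energy_density_Pair:
  "continuous_on UNIV (\<lambda>y :: (real^3) \<times> state_value. energy_density (fst y) (snd y))"
proof -
  obtain k K where Nv_cont: "continuous_on UNIV Nv" using Nv by (rule is_norm_bounds) blast
  have 1: "continuous_on UNIV (\<lambda>y :: (real^3) \<times> state_value. Nv (fst (snd y) - fst y))"
    by (rule continuous_on_compose2[OF Nv_cont, where f="\<lambda>y :: (real^3) \<times> state_value. fst (snd y) - fst y"])
      (auto intro!: continuous_intros)
  have 2: "continuous_on UNIV (\<lambda>y :: (real^3) \<times> state_value. G (fst (snd (snd y)), fst (snd (snd (snd y))), max 0 (snd (snd (snd (snd y))))))"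
    by (rule continuous_on_compose2[OF continuous, where f="\<lambda>y :: (real^3) \<times> state_value. (fst (snd (snd y)), fst (snd (snd (snd y))), max 0 (snd (snd (snd (snd y)))))"])
      (auto simp: half_space_def intro!: continuous_intros)
  show ?thesis unfolding energy_density_def by (intro continuous_intros 1 2)
qed

lemma continuous_on_energy_density: "continuous_on S (energy_density a)"
proof -
  have "continuous_on S (\<lambda>U. energy_density (fst (a, U)) (snd (a, U)))"
    by (rule continuous_on_compose2[OF continuous_on_energy_density_Pair]) (auto intro!: continuous_intros)
  thus ?thesis by simp
qed

lemma measurable_energy_density:
  assumes "a \<in> borel_measurable M" "U \<in> borel_measurable M"
  shows "(\<lambda>x. energy_density (a x) (U x)) \<in> borel_measurable M"
  using measurable_compose[OF borel_measurable_Pair[OF assms] borel_measurable_continuous_onI[OF continuous_on_energy_density_Pair]]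
  by simp

text \<open>Composition with \<open>max 0\<close> may destroy convexity where \<open>w < 0\<close>,
  since \<open>G\<close> may decrease in \<open>w\<close>; on the half-space the maximum is inactive
  and the density is convex up to a constant.\<close>

lemma convex_on_energy_density: "convex_on {U. 0 \<le> snd (snd (snd U))} (energy_density a)"
proof -
  let ?S = "{U :: state_value. 0 \<le> snd (snd (snd U))}"
  have cvx: "convex ?S" by (auto simp: convex_def)
  have "convex_on ?S (\<lambda>U. Nv (fst U - a) ^ 2)"
    by (rule convex_on_compose_affine[OF is_norm_convex_on_power[OF Nv] cvx, of 2 "\<lambda>U. fst U - a"])
      (auto simp: algebra_simps)
  hence 1: "convex_on ?S (\<lambda>U. 1/2 * Nv (fst U - a) ^ 2)" by (intro convex_on_cmul) auto
  have 2: "convex_on ?S (\<lambda>U. G (snd U))"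
    by (rule convex_on_compose_affine[OF convex cvx]) (auto simp: half_space_def)
  have 3: "convex_on ?S (\<lambda>U. 1/2 * Nv (fst U - a) ^ 2 + G (snd U))"
    by (intro convex_on_add 1 2)
  have eq: "energy_density a U = (1/2 * Nv (fst U - a) ^ 2 + G (snd U)) - C2" if "U \<in> ?S" for U
    using that by (simp add: energy_density_def max_absorb2)
  show ?thesis
  proof (rule convex_onI[OF _ cvx])
    fix t :: real and U V assume t: "0 < t" "t < 1" and UV: "U \<in> ?S" "V \<in> ?S"
    have mem: "(1 - t) *\<^sub>R U + t *\<^sub>R V \<in> ?S" using convexD[OF cvx UV, of "1 - t" t] t by simp
    show "energy_density a ((1 - t) *\<^sub>R U + t *\<^sub>R V) \<le> (1 - t) * energy_density a U + t * energy_density a V"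
      unfolding eq[OF UV(1)] eq[OF UV(2)] eq[OF mem]
      using convex_onD[OF 3, of t U V] t UV by (simp add: algebra_simps)
  qed
qed

lemma energy_density_bounds:
  obtains B where "0 < B"
    "\<And>a v F Z w. 0 \<le> w \<Longrightarrow>
       norm (v - a) powr 2 + norm F powr p + norm Z powr q + norm w powr r \<le> B * energy_density a (v, F, Z, w)"
    "\<And>a v F Z w. 0 \<le> w \<Longrightarrow>
       energy_density a (v, F, Z, w) \<le> B * (norm (v - a) powr 2 + norm F powr p + norm Z powr q + norm w powr r + 1)"
proof -
  obtain kv Kv where v: "0 < kv" "0 < Kv" "\<And>x. kv * norm x \<le> Nv x" "\<And>x. Nv x \<le> Kv * norm x"
    using Nv by (rule is_norm_bounds) blast
  obtain km Km where m: "0 < km" "0 < Km" "\<And>x. km * norm x \<le> Nm x" "\<And>x. Nm x \<le> Km * norm x"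
    using Nm by (rule is_norm_bounds) blast
  have m_nonneg: "0 \<le> Nm x" "0 \<le> Nv y" for x y using Nm Nv by (auto simp: is_norm_def)
  have lower: "km powr s * norm x powr s \<le> Nm x powr s" and upper: "Nm x powr s \<le> Km powr s * norm x powr s"
    if "0 \<le> s" for x s
    unfolding powr_mult[symmetric] using that m(1,2) m(3,4)[of x] m_nonneg(1)
    by (auto intro!: powr_mono2 simp: powr_mult[symmetric])
  have v2: "kv\<^sup>2 * norm x powr 2 \<le> Nv x ^ 2" "Nv x ^ 2 \<le> Kv\<^sup>2 * norm x powr 2" for x
    using power_mono[OF v(3)[of x], of 2] power_mono[OF v(4)[of x], of 2] v(1) m_nonneg(2)
    by (simp_all add: power_mult_distrib)
  \<comment> \<open>The least coefficient of the four lower bounds; the term in \<open>w\<close>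
    involves no change of norm, so its coefficient is \<open>C1\<close> itself.\<close>
  define b where "b = min (min (kv\<^sup>2 / 2) (C1 * km powr p)) (min (C1 * km powr q) C1)"
  have b: "0 < b" "b \<le> kv\<^sup>2 / 2" "b \<le> C1 * km powr p" "b \<le> C1 * km powr q" "b \<le> C1"
    using v(1) m(1) C1_pos by (auto simp: b_def)
  \<comment> \<open>The absolute value of \<open>C2\<close> accounts for the shift by
    \<open>- C2\<close>; together with \<open>c\<close> it is the coefficient of the summand
    1.\<close>
  define B' where "B' = Kv\<^sup>2 / 2 + c * Km powr p + c * Km powr q + c + \<bar>C2\<bar>"
  have B': "Kv\<^sup>2 / 2 \<le> B'" "c * Km powr p \<le> B'" "c * Km powr q \<le> B'" "c + \<bar>C2\<bar> \<le> B'" "c \<le> B'"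
    using c_pos by (auto simp: B'_def add_nonneg_nonneg)
  have low: "b * (norm (v - a) powr 2 + norm F powr p + norm Z powr q + norm w powr r) \<le> energy_density a (v, F, Z, w)"
    if w: "0 \<le> w" for a v F Z w
  proof -
    have "b * norm (v - a) powr 2 \<le> kv\<^sup>2 / 2 * norm (v - a) powr 2"
      by (intro mult_right_mono b) auto
    also have "\<dots> \<le> 1/2 * Nv (v - a) ^ 2" using v2(1)[of "v - a"] by simp
    finally have 1: "b * norm (v - a) powr 2 \<le> 1/2 * Nv (v - a) ^ 2" .
    have "b * norm F powr p \<le> C1 * km powr p * norm F powr p" by (intro mult_right_mono b) auto
    also have "\<dots> \<le> C1 * Nm F powr p"
      using lower[of p F] exponents C1_pos by (simp add: mult.assoc mult_left_mono)
    finally have 2: "b * norm F powr p \<le> C1 * Nm F powr p" .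
    have "b * norm Z powr q \<le> C1 * km powr q * norm Z powr q" by (intro mult_right_mono b) auto
    also have "\<dots> \<le> C1 * Nm Z powr q"
      using lower[of q Z] exponents C1_pos by (simp add: mult.assoc mult_left_mono)
    finally have 3: "b * norm Z powr q \<le> C1 * Nm Z powr q" .
    have 4: "b * norm w powr r \<le> C1 * w powr r" using w b by (intro mult_mono) auto
    have "energy_density a (v, F, Z, w) = 1/2 * Nv (v - a) ^ 2 + (G (F, Z, w) - C2)"
      using w by (simp add: energy_density_def max_absorb2)
    thus ?thesis using 1 2 3 4 coercive[OF w, of F Z] by (simp add: distrib_left)
  qed
  have up: "energy_density a (v, F, Z, w) \<le> B' * (norm (v - a) powr 2 + norm F powr p + norm Z powr q + norm w powr r + 1)"
    if w: "0 \<le> w" for a v F Z w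
  proof -
    have "1/2 * Nv (v - a) ^ 2 \<le> Kv\<^sup>2 / 2 * norm (v - a) powr 2" using v2(2)[of "v - a"] by simp
    also have "\<dots> \<le> B' * norm (v - a) powr 2" by (intro mult_right_mono B') auto
    finally have 1: "1/2 * Nv (v - a) ^ 2 \<le> B' * norm (v - a) powr 2" .
    have "c * Nm F powr p \<le> c * Km powr p * norm F powr p"
      using upper[of p F] exponents c_pos by (simp add: mult.assoc mult_left_mono)
    also have "\<dots> \<le> B' * norm F powr p" by (intro mult_right_mono B') auto
    finally have 2: "c * Nm F powr p \<le> B' * norm F powr p" .
    have "c * Nm Z powr q \<le> c * Km powr q * norm Z powr q"
      using upper[of q Z] exponents c_pos by (simp add: mult.assoc mult_left_mono)
    also have "\<dots> \<le> B' * norm Z powr q" by (intro mult_right_mono B') auto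
    finally have 3: "c * Nm Z powr q \<le> B' * norm Z powr q" .
    have 4: "c * w powr r \<le> B' * norm w powr r" using w B' c_pos by (intro mult_mono) auto
    have "energy_density a (v, F, Z, w) = 1/2 * Nv (v - a) ^ 2 + (G (F, Z, w) - C2)"
      using w by (simp add: energy_density_def max_absorb2)
    thus ?thesis using 1 2 3 4 B'(4) growth[OF w, of F Z] by (simp add: distrib_left)
  qed
  show thesis
  proof (rule that[of "max B' (1 / b)"])
    show "0 < max B' (1 / b)" using b by (auto simp: less_max_iff_disj)
    fix a v :: "real^3" and F Z :: "real^3^3" and w :: real assume w: "0 \<le> w"
    let ?n = "norm (v - a) powr 2 + norm F powr p + norm Z powr q + norm w powr r"
    have "?n \<le> 1 / b * energy_density a (v, F, Z, w)" using low[OF w, of v a F Z] b(1) by (simp add: field_simps)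
    also have "\<dots> \<le> max B' (1 / b) * energy_density a (v, F, Z, w)"
      by (intro mult_right_mono energy_density_nonneg) auto
    finally show "?n \<le> max B' (1 / b) * energy_density a (v, F, Z, w)" .
    have "energy_density a (v, F, Z, w) \<le> B' * (?n + 1)" by (rule up[OF w])
    also have "\<dots> \<le> max B' (1 / b) * (?n + 1)"
      by (intro mult_right_mono add_nonneg_nonneg) auto
    finally show "energy_density a (v, F, Z, w) \<le> max B' (1 / b) * (?n + 1)" .
  qed
qed

lemma integrable_energy_density:
  assumes "finite_measure M" "v0 \<in> Lsp M 2"
    and X: "v \<in> Lsp M 2" "F \<in> Lsp M p" "Z \<in> Lsp M q" "w \<in> Lsp M r" and w: "AE x in M. 0 \<le> w x"
  shows "integrable M (\<lambda>x. energy_density (v0 x) (v x, F x, Z x, w x))"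
proof -
  interpret finite_measure M by fact
  obtain B where B: "0 < B" "\<And>a v F Z w. 0 \<le> w \<Longrightarrow>
       energy_density a (v, F, Z, w) \<le> B * (norm (v - a) powr 2 + norm F powr p + norm Z powr q + norm w powr r + 1)"
    by (rule energy_density_bounds) blast
  have diff: "(\<lambda>x. v x - v0 x) \<in> Lsp M 2" using assms by (intro Lsp_diff) auto
  show ?thesis
  proof (rule Bochner_Integration.integrable_bound)
    show "integrable M (\<lambda>x. B * (norm (v x - v0 x) powr 2 + norm (F x) powr p + norm (Z x) powr q + norm (w x) powr r + 1))"
      using LspD(2)[OF diff] LspD(2)[OF X(2)] LspD(2)[OF X(3)] LspD(2)[OF X(4)]
      by (intro integrable_mult_right Bochner_Integration.integrable_add) auto
    show "(\<lambda>x. energy_density (v0 x) (v x, F x, Z x, w x)) \<in> borel_measurable M"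
      by (intro measurable_energy_density borel_measurable_Pair LspD(1)[OF assms(2)] LspD(1)[OF X(1)]
          LspD(1)[OF X(2)] LspD(1)[OF X(3)] LspD(1)[OF X(4)])
    show "AE x in M. norm (energy_density (v0 x) (v x, F x, Z x, w x))
        \<le> norm (B * (norm (v x - v0 x) powr 2 + norm (F x) powr p + norm (Z x) powr q + norm (w x) powr r + 1))"
      using w
    proof eventually_elim
      case (elim x)
      from B(2)[OF elim, of "v0 x" "v x" "F x" "Z x"] energy_density_nonneg[of "v0 x" "(v x, F x, Z x, w x)"]
      show ?case unfolding real_norm_def by linarith
    qed
  qed
qed

text \<open>By the growth bound the density is integrable, so the extended integral is an ordinary
  one; undoing the shift adds \<open>C2\<close> times the volume of the cell.\<close>

lemma functional_I_eq:
  assumes "v0 \<in> Lsp (torus l) 2"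
    and X: "(v, F, Z, w) \<in> space_X l p q r" and w: "AE x in torus l. 0 \<le> w x"
  shows "functional_I l Nv G v0 (v, F, Z, w) =
    ereal ((LINT x|torus l. energy_density (v0 x) (v x, F x, Z x, w x)) + C2 * measure (torus l) (space (torus l)))"
proof -
  interpret finite_measure "torus l" by (rule finite_measure_torus)
  have int: "integrable (torus l) (\<lambda>x. energy_density (v0 x) (v x, F x, Z x, w x))"
    using X by (intro integrable_energy_density finite_measure_torus assms(1) w) (auto simp: space_X_def)
  have "functional_I l Nv G v0 (v, F, Z, w) = ext_integral (torus l) (\<lambda>x. energy_density (v0 x) (v x, F x, Z x, w x) + C2)"
    unfolding functional_I_def prod.case
    by (rule ext_integral_cong_AE, use w in eventually_elim) (simp add: energy_density_def max_absorb2)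
  also have "\<dots> = ereal (LINT x|torus l. energy_density (v0 x) (v x, F x, Z x, w x) + C2)"
    by (intro ext_integral_eq_integral Bochner_Integration.integrable_add int) auto
  also have "(LINT x|torus l. energy_density (v0 x) (v x, F x, Z x, w x) + C2)
      = (LINT x|torus l. energy_density (v0 x) (v x, F x, Z x, w x)) + C2 * measure (torus l) (space (torus l))"
    using int by (subst Bochner_Integration.integral_add) auto
  finally show ?thesis .
qed

end

subsection \<open>Admissible weak limits\<close>

context finite_measure
begin

lemma weakly_converges_of_L2:
  fixes u :: "nat \<Rightarrow> 'a \<Rightarrow> 'b::euclidean_space"
  assumes p: "2 \<le> p" and u: "\<And>n. u n \<in> Lsp M p" and B: "\<And>n. power_integral M p (u n) \<le> B"
    and w: "w \<in> Lsp M 2"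
    and lim: "\<And>g. g \<in> Lsp M 2 \<Longrightarrow> (\<lambda>n. LINT x|M. u n x \<bullet> g x) \<longlonglongrightarrow> (LINT x|M. w x \<bullet> g x)"
  shows "weakly_converges M p u w"
proof -
  have B0: "0 \<le> B" using B[of 0] power_integral_nonneg order.trans by blast
  have u2: "u n \<in> Lsp M 2" for n using Lsp_mono(1)[OF u, of 2] p by simp
  have u2_bound: "power_integral M 2 (u n) \<le> measure M (space M) + B" for n
    using Lsp_mono(2)[OF u, of 2 n] B[of n] p by simp
  have meas: "(\<lambda>x. norm (u n x) powr p) \<in> borel_measurable M" for n
    using LspD(2)[OF u[of n]] by (rule borel_measurable_integrable)
  have cont: "continuous_on UNIV (\<lambda>y::'b. norm y powr p)"
    using p by (intro continuous_on_powr') (auto intro!: continuous_intros)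
  \<comment> \<open>The limit is so far known to be in L2 only. Lower semicontinuity for the convex
    function \<open>norm y powr p\<close> puts it into \<open>Lsp M p\<close>.\<close>
  have "(\<integral>\<^sup>+x. ennreal (norm (w x) powr p) \<partial>M) \<le> ennreal B"
  proof (rule weak_lsc_convex_integral[OF u2 u2_bound w lim, where f="\<lambda>_ y. norm y powr p" and S=UNIV])
    show "(\<integral>\<^sup>+x. ennreal (norm (u n x) powr p) \<partial>M) \<le> ennreal B" for n
      unfolding nn_integral_norm_powr[OF u] by (rule ennreal_leI[OF B])
    show "convex_on UNIV (\<lambda>y::'b. norm y powr p)"
      using p by (intro is_norm_convex_on_powr is_norm_norm) auto
  qed (use meas cont in auto)
  hence wp: "w \<in> Lsp M p" using LspD(1)[OF w] B0 by (intro LspI_nn_integral(1))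
  show ?thesis
  proof (rule weakly_converges_of_bounded_tests[OF p u B wp])
    fix g :: "'a \<Rightarrow> 'b" and K assume "g \<in> borel_measurable M" "\<And>x. norm (g x) \<le> K"
    hence "g \<in> Lsp M 2" by (intro Lsp_bounded[where B=K]) auto
    thus "(\<lambda>n. LINT x|M. u n x \<bullet> g x) \<longlonglongrightarrow> (LINT x|M. w x \<bullet> g x)" by (rule lim)
  qed
qed

end

lemma Lsp_fst:
  fixes f :: "'a \<Rightarrow> 'b::euclidean_space \<times> 'c::euclidean_space"
  assumes "f \<in> Lsp M p" "0 \<le> p"
  shows "(\<lambda>x. fst (f x)) \<in> Lsp M p"
proof -
  have "norm (fst y) \<le> norm y" for y :: "'b \<times> 'c" using norm_fst_le[of "fst y" "snd y"] by simp
  thus ?thesis using assms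
    by (intro Lsp_compose_contraction[where T=fst] borel_measurable_continuous_onI continuous_on_fst continuous_on_id)
qed

lemma Lsp_snd:
  fixes f :: "'a \<Rightarrow> 'b::euclidean_space \<times> 'c::euclidean_space"
  assumes "f \<in> Lsp M p" "0 \<le> p"
  shows "(\<lambda>x. snd (f x)) \<in> Lsp M p"
proof -
  have "norm (snd y) \<le> norm y" for y :: "'b \<times> 'c" using norm_snd_le[of "snd y" "fst y"] by simp
  thus ?thesis using assms
    by (intro Lsp_compose_contraction[where T=snd] borel_measurable_continuous_onI continuous_on_snd continuous_on_id)
qed

lemma Lsp_torus_continuous_mult:
  fixes f \<theta> :: "real^3 \<Rightarrow> real"
  assumes "continuous_on UNIV \<theta>" "f \<in> Lsp (torus l) 2"
  shows "(\<lambda>x. f x * \<theta> x) \<in> Lsp (torus l) 2"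
proof -
  obtain B where "\<theta> \<in> borel_measurable (torus l)" "AE x in torus l. \<bar>\<theta> x\<bar> \<le> B"
    using assms(1) by (rule continuous_measurable_bounded_on_torus)
  from Lsp_bounded_scaleR[OF assms(2) this] show ?thesis by (simp add: mult.commute)
qed

theorem theorem2:
  fixes l :: "real^3"
    and Nv :: "real^3 \<Rightarrow> real" and Nm :: "real^3^3 \<Rightarrow> real"
    and h :: real
    and W :: "real^3^3 \<Rightarrow> real"
    and G :: "(real^3^3) \<times> (real^3^3) \<times> real \<Rightarrow> real"
    and dFG dZG :: "real^3^3 \<Rightarrow> real^3^3 \<Rightarrow> real \<Rightarrow> real^3^3"
    and dwG :: "real^3^3 \<Rightarrow> real^3^3 \<Rightarrow> real \<Rightarrow> real"
    and C1 C2 c C p p' q r s :: real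
    and M :: "real^3 \<Rightarrow> real"
    and A :: "real^3^3"
    and y0 v0 :: "real^3 \<Rightarrow> real^3"
    and F0 Z0 :: "real^3 \<Rightarrow> real^3^3"
    and w0 :: "real^3 \<Rightarrow> real"
    and vs :: "nat \<Rightarrow> real^3 \<Rightarrow> real^3"
    and Fs Zs :: "nat \<Rightarrow> real^3 \<Rightarrow> real^3^3"
    and ws :: "nat \<Rightarrow> real^3 \<Rightarrow> real"
  assumes periods: "\<And>i. 0 < l $ i"
    and norms: "is_norm Nv" "is_norm Nm"
    and time_step: "0 < h"
    and exponents: "3 \<le> p" "2 \<le> q" "2 \<le> r"
    and polyconvexity:
      "convex_on half_space G" "C2_on half_space G"
      "\<And>F. 0 \<le> det F \<Longrightarrow> G (F, cof F, det F) = W F"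
    and coercivity: "0 < C1"
      "\<And>F Z w. 0 \<le> w \<Longrightarrow> C1 * (Nm F powr p + Nm Z powr q + w powr r) + C2 \<le> G (F, Z, w)"
    and growth: "0 < c"
      "\<And>F Z w. 0 \<le> w \<Longrightarrow> G (F, Z, w) \<le> c * (Nm F powr p + Nm Z powr q + w powr r + 1)"
    and partial_derivatives:
      "\<And>F Z w. 0 \<le> w \<Longrightarrow>
         (G has_derivative (\<lambda>(H, K, t). dFG F Z w \<bullet> H + dZG F Z w \<bullet> K + dwG F Z w * t))
           (at (F, Z, w) within half_space)"
    and derivative_growth: "0 < C"
      "3 < p \<Longrightarrow> p' = p / (p - 1)" "p = 3 \<Longrightarrow> p' < 3 / 2"
      "\<And>F Z w. 0 \<le> w \<Longrightarrow>
         Nm (dFG F Z w) powr p' + Nm (dZG F Z w) powr (p * p' / (p - p')) +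
           \<bar>dwG F Z w\<bar> powr (p * p' / (p - 2 * p'))
         \<le> C * (Nm F powr p + Nm Z powr q + w powr r + 1)"
    and M: "2 < s" "M \<in> Lsp (torus l) s"
    and initial_data:
      "y0 \<in> W1 l A p \<inter> FD Nm l A"
      "v0 \<in> Lsp (torus l) 2"
      "weak_gradient l A y0 F0" "F0 \<in> Lsp (torus l) p"
      "AE x in torus l. Z0 x = cof (F0 x)" "Z0 \<in> Lsp (torus l) q"
      "AE x in torus l. w0 x = det (F0 x)" "w0 \<in> Lsp (torus l) r"
      "AE x in torus l. Nm (F0 x) ^ 3 \<le> M x * w0 x"
      "AE x in torus l. 0 \<le> w0 x"
      "ext_integral (torus l) (\<lambda>x. 1/2 * Nv (v0 x) ^ 2 + G (F0 x, Z0 x, w0 x)) < \<infinity>"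
    and sequence:
      "\<And>n. (vs n, Fs n, Zs n, ws n) \<in> admissible l Nv Nm G h p q r M v0 F0 Z0 w0"
      "(SUP n. functional_I l Nv G v0 (vs n, Fs n, Zs n, ws n)) < \<infinity>"
  shows "\<exists>v F Z w \<mu>.
    (v, F, Z, w) \<in> space_X l p q r \<and> strict_mono (\<mu> :: nat \<Rightarrow> nat) \<and>
    weakly_converges (torus l) 2 (\<lambda>n. vs (\<mu> n)) v \<and>
    weakly_converges (torus l) p (\<lambda>n. Fs (\<mu> n)) F \<and>
    weakly_converges (torus l) q (\<lambda>n. Zs (\<mu> n)) Z \<and>
    weakly_converges (torus l) r (\<lambda>n. ws (\<mu> n)) w \<and>
    (v, F, Z, w) \<in> admissible l Nv Nm G h p q r M v0 F0 Z0 w0 \<and>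
    functional_I l Nv G v0 (v, F, Z, w)
      \<le> liminf (\<lambda>n. functional_I l Nv G v0 (vs n, Fs n, Zs n, ws n)) \<and>
    liminf (\<lambda>n. functional_I l Nv G v0 (vs n, Fs n, Zs n, ws n)) < \<infinity>"
proof -
  let ?T = "torus l"
  interpret T: finite_measure ?T by (rule finite_measure_torus)
  have G_cont: "continuous_on half_space G"
    unfolding continuous_on_eq_continuous_within
  proof
    fix y assume "y \<in> half_space"
    then obtain F Z w where y: "y = (F, Z, w)" "0 \<le> w" by (auto simp: half_space_def)
    show "continuous (at y within half_space) G"
      unfolding y(1) by (rule has_derivative_continuous[OF partial_derivatives[OF y(2)]])
  qed
  interpret E: polyconvex_energy Nv Nm G C1 C2 c p q r
    using norms exponents polyconvexity(1) G_cont coercivity growth by unfold_locales auto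

  \<comment> \<open>A priori bounds from the energy\<close>
  define m where "m = measure ?T (space ?T)"
  have v0: "v0 \<in> Lsp ?T 2" by (rule initial_data(2))
  have X: "vs n \<in> Lsp ?T 2" "Fs n \<in> Lsp ?T p" "Zs n \<in> Lsp ?T q" "ws n \<in> Lsp ?T r"
    and X': "(vs n, Fs n, Zs n, ws n) \<in> space_X l p q r"
    and distortion: "AE x in ?T. Nm (Fs n x) ^ 3 \<le> M x * ws n x"
    and w_nonneg: "AE x in ?T. 0 \<le> ws n x" for n
    using sequence(1)[of n] by (auto simp: admissible_def space_X_def)
  have constraint_F: "(LINT x|?T. \<theta> x * (1/h * (Fs n x $ i $ a - F0 x $ i $ a))) = - (LINT x|?T. vs n x $ i * pd a \<theta> x)"
    and constraint_Z: "(LINT x|?T. \<theta> x * (1/h * (Zs n x $ k $ c - Z0 x $ k $ c))) =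
               - (LINT x|?T. (\<Sum>i\<in>UNIV. \<Sum>j\<in>UNIV. \<Sum>a\<in>UNIV. \<Sum>b\<in>UNIV.
                    perm_symbol i j k * perm_symbol a b c * F0 x $ j $ b * vs n x $ i * pd a \<theta> x))"
    and constraint_w: "(LINT x|?T. \<theta> x * (1/h * (ws n x - w0 x))) =
          - (LINT x|?T. (\<Sum>i\<in>UNIV. \<Sum>a\<in>UNIV. cof (F0 x) $ i $ a * vs n x $ i * pd a \<theta> x))"
    if "\<theta> \<in> test_functions l" for \<theta> n i a k c
    using sequence(1)[of n] that unfolding admissible_def by blast+
  define I where "I n = functional_I l Nv G v0 (vs n, Fs n, Zs n, ws n)" for n
  define J where "J n = (LINT x|?T. E.energy_density (v0 x) (vs n x, Fs n x, Zs n x, ws n x))" for n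
  have J_int: "integrable ?T (\<lambda>x. E.energy_density (v0 x) (vs n x, Fs n x, Zs n x, ws n x))" for n
    by (intro E.integrable_energy_density finite_measure_torus v0 X w_nonneg)
  have J_nonneg: "0 \<le> J n" for n unfolding J_def by (simp add: E.energy_density_nonneg)
  have I_eq: "I n = ereal (J n + C2 * m)" for n
    unfolding I_def J_def m_def by (rule E.functional_I_eq[OF v0 X' w_nonneg])
  have I_le: "I n \<le> (SUP n. I n)" for n by (rule SUP_upper) simp
  obtain K where K: "(SUP n. I n) \<le> ereal K"
    using sequence(2) unfolding I_def[symmetric] by (cases "SUP n. I n") auto
  have J_le: "J n \<le> K - C2 * m" for n
    using order.trans[OF I_le[of n] K] by (simp add: I_eq algebra_simps)
  obtain B where B: "0 < B" "\<And>a v F Z w. 0 \<le> w \<Longrightarrow>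
      norm (v - a) powr 2 + norm F powr p + norm Z powr q + norm w powr r \<le> B * E.energy_density a (v, F, Z, w)"
    by (rule E.energy_density_bounds) blast
  define D where "D = B * (K - C2 * m)"
  \<comment> \<open>One estimate for all four power integrals: each integrand is a summand of the
    quantity that coercivity bounds by the energy density.\<close>
  have part_le: "(LINT x|?T. g x) \<le> D"
    if "integrable ?T g" "AE x in ?T. g x \<le> norm (vs n x - v0 x) powr 2 + norm (Fs n x) powr p
      + norm (Zs n x) powr q + norm (ws n x) powr r" for g :: "real^3 \<Rightarrow> real" and n
  proof -
    have "AE x in ?T. g x \<le> B * E.energy_density (v0 x) (vs n x, Fs n x, Zs n x, ws n x)"
      using that(2) w_nonneg[of n]
      by eventually_elim (rule order.trans[OF _ B(2)])
    hence "(LINT x|?T. g x) \<le> (LINT x|?T. B * E.energy_density (v0 x) (vs n x, Fs n x, Zs n x, ws n x))"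
      by (intro integral_mono_AE that(1) integrable_mult_right J_int)
    also have "\<dots> = B * J n" by (simp add: J_def)
    also have "\<dots> \<le> D" unfolding D_def using B(1) J_le by (intro mult_left_mono) auto
    finally show ?thesis .
  qed
  have vdiff: "(\<lambda>x. vs n x - v0 x) \<in> Lsp ?T 2" for n by (intro Lsp_diff X v0) auto
  have v_diff_bound: "power_integral ?T 2 (\<lambda>x. vs n x - v0 x) \<le> D" for n
    unfolding power_integral_def by (rule part_le[OF LspD(2)[OF vdiff[of n]], of n]) (auto intro!: always_eventually)
  have F_bound: "power_integral ?T p (Fs n) \<le> D" for n
    unfolding power_integral_def by (rule part_le[OF LspD(2)[OF X(2)[of n]], of n]) (auto intro!: always_eventually)
  have Z_bound: "power_integral ?T q (Zs n) \<le> D" for n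
    unfolding power_integral_def by (rule part_le[OF LspD(2)[OF X(3)[of n]], of n]) (auto intro!: always_eventually)
  have w_bound: "power_integral ?T r (ws n) \<le> D" for n
    unfolding power_integral_def by (rule part_le[OF LspD(2)[OF X(4)[of n]], of n]) (auto intro!: always_eventually)
  \<comment> \<open>The factor 4 is the \<open>2 powr 2\<close> of
    \<open>power_integral_add_le\<close>, paid for adding \<open>v0\<close> back to the controlled
    difference.\<close>
  define Dv where "Dv = 4 * (D + power_integral ?T 2 v0)"
  have v_bound: "power_integral ?T 2 (vs n) \<le> Dv" for n
    using power_integral_add_le[OF _ vdiff v0, of n] v_diff_bound[of n] unfolding Dv_def by simp
  have F2: "Fs n \<in> Lsp ?T 2" "power_integral ?T 2 (Fs n) \<le> m + D" for n
    using T.Lsp_mono[OF X(2), of 2 n] F_bound[of n] exponents by (auto simp: m_def)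
  have Z2: "Zs n \<in> Lsp ?T 2" "power_integral ?T 2 (Zs n) \<le> m + D" for n
    using T.Lsp_mono[OF X(3), of 2 n] Z_bound[of n] exponents by (auto simp: m_def)
  have w2: "ws n \<in> Lsp ?T 2" "power_integral ?T 2 (ws n) \<le> m + D" for n
    using T.Lsp_mono[OF X(4), of 2 n] w_bound[of n] exponents by (auto simp: m_def)

  \<comment> \<open>Extraction of a weakly convergent subsequence\<close>
  define U where "U n x = (vs n x, Fs n x, Zs n x, ws n x)" for n x
  have U: "U n \<in> Lsp ?T 2" for n
    unfolding U_def by (intro Lsp_2_Pair X F2 Z2 w2)
  have U_bound: "power_integral ?T 2 (U n) \<le> Dv + (m + D) + (m + D) + (m + D)" for n
  proof -
    have "power_integral ?T 2 (U n) = power_integral ?T 2 (vs n) + (power_integral ?T 2 (Fs n)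
        + (power_integral ?T 2 (Zs n) + power_integral ?T 2 (ws n)))"
      unfolding U_def by (simp add: Lsp_2_Pair X F2 Z2 w2)
    thus ?thesis using v_bound[of n] F2(2)[of n] Z2(2)[of n] w2(2)[of n] by simp
  qed
  \<comment> \<open>The energies are made to converge to the lower limit beforehand; the further
    extraction \<open>\<nu>\<close> keeps this limit, so the final estimate concerns the lower limit
    of the full sequence.\<close>
  obtain \<rho> where \<rho>: "strict_mono \<rho>" "(I \<circ> \<rho>) \<longlonglongrightarrow> liminf I" using liminf_subseq_lim by blast
  obtain \<nu> U' where \<nu>: "strict_mono (\<nu> :: nat \<Rightarrow> nat)" and U': "U' \<in> Lsp ?T 2"
    and U_lim': "\<And>g. g \<in> Lsp ?T 2 \<Longrightarrow> (\<lambda>n. LINT x|?T. U (\<rho> (\<nu> n)) x \<bullet> g x) \<longlonglongrightarrow> (LINT x|?T. U' x \<bullet> g x)"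
    by (rule T.L2_bounded_weakly_convergent_subseq[of "\<lambda>n. U (\<rho> n)", OF U U_bound]) blast
  define \<mu> where "\<mu> = \<rho> \<circ> \<nu>"
  have \<mu>: "strict_mono \<mu>" unfolding \<mu>_def by (rule strict_mono_o[OF \<rho>(1) \<nu>])
  have U_lim: "(\<lambda>n. LINT x|?T. U (\<mu> n) x \<bullet> g x) \<longlonglongrightarrow> (LINT x|?T. U' x \<bullet> g x)" if "g \<in> Lsp ?T 2" for g
    using U_lim'[OF that] by (simp add: \<mu>_def)
  define v F Z w where "v x = fst (U' x)" and "F x = fst (snd (U' x))"
    and "Z x = fst (snd (snd (U' x)))" and "w x = snd (snd (snd (U' x)))" for x
  have U'_eq: "U' x = (v x, F x, Z x, w x)" for x by (simp add: v_def F_def Z_def w_def)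
  have U2: "(\<lambda>x. snd (U' x)) \<in> Lsp ?T 2" by (intro Lsp_snd U') simp
  have U3: "(\<lambda>x. snd (snd (U' x))) \<in> Lsp ?T 2" by (intro Lsp_snd[OF U2]) simp
  have v_L2: "v \<in> Lsp ?T 2" unfolding v_def by (intro Lsp_fst U') simp
  have F_L2: "F \<in> Lsp ?T 2" unfolding F_def by (intro Lsp_fst U2) simp
  have Z_L2: "Z \<in> Lsp ?T 2" unfolding Z_def by (intro Lsp_fst U3) simp
  have w_L2: "w \<in> Lsp ?T 2" unfolding w_def by (intro Lsp_snd U3) simp
  \<comment> \<open>Test fields with a single nonzero component isolate the components of the weak
    limit.\<close>
  have v_lim: "(\<lambda>n. LINT x|?T. vs (\<mu> n) x \<bullet> g x) \<longlonglongrightarrow> (LINT x|?T. v x \<bullet> g x)" if "g \<in> Lsp ?T 2" for g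
    using U_lim[of "\<lambda>x. (g x, 0, 0, 0)"] that unfolding U_def U'_eq by (simp add: Lsp_2_Pair)
  have F_lim: "(\<lambda>n. LINT x|?T. Fs (\<mu> n) x \<bullet> g x) \<longlonglongrightarrow> (LINT x|?T. F x \<bullet> g x)" if "g \<in> Lsp ?T 2" for g
    using U_lim[of "\<lambda>x. (0, g x, 0, 0)"] that unfolding U_def U'_eq by (simp add: Lsp_2_Pair)
  have Z_lim: "(\<lambda>n. LINT x|?T. Zs (\<mu> n) x \<bullet> g x) \<longlonglongrightarrow> (LINT x|?T. Z x \<bullet> g x)" if "g \<in> Lsp ?T 2" for g
    using U_lim[of "\<lambda>x. (0, 0, g x, 0)"] that unfolding U_def U'_eq by (simp add: Lsp_2_Pair)
  have w_lim: "(\<lambda>n. LINT x|?T. ws (\<mu> n) x \<bullet> g x) \<longlonglongrightarrow> (LINT x|?T. w x \<bullet> g x)" if "g \<in> Lsp ?T 2" for g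
    using U_lim[of "\<lambda>x. (0, 0, 0, g x)"] that unfolding U_def U'_eq by (simp add: Lsp_2_Pair)
  have v_weak: "weakly_converges ?T 2 (\<lambda>n. vs (\<mu> n)) v"
    by (rule T.weakly_converges_of_L2[OF _ X(1) v_bound v_L2 v_lim]) auto
  have F_weak: "weakly_converges ?T p (\<lambda>n. Fs (\<mu> n)) F"
    by (rule T.weakly_converges_of_L2[OF _ X(2) F_bound F_L2 F_lim]) (use exponents in auto)
  have Z_weak: "weakly_converges ?T q (\<lambda>n. Zs (\<mu> n)) Z"
    by (rule T.weakly_converges_of_L2[OF _ X(3) Z_bound Z_L2 Z_lim]) (use exponents in auto)
  have w_weak: "weakly_converges ?T r (\<lambda>n. ws (\<mu> n)) w"
    by (rule T.weakly_converges_of_L2[OF _ X(4) w_bound w_L2 w_lim]) (use exponents in auto)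
  have X_lim: "(v, F, Z, w) \<in> space_X l p q r"
    using v_weak F_weak Z_weak w_weak by (simp add: space_X_def weakly_converges_def)

  \<comment> \<open>Sign and distortion conditions for the limit\<close>
  have pointwise: "AE x in ?T. U' x \<in> {Y. 0 \<le> snd (snd (snd Y)) \<and> Nm (fst (snd Y)) ^ 3 \<le> M x * snd (snd (snd Y))}"
  proof (rule T.weak_limit_in_closed_convex[OF U U_bound U' U_lim])
    obtain k K where Nm_cont: "continuous_on UNIV Nm" using norms(2) by (rule is_norm_bounds) blast
    fix x
    have Nm_cont': "continuous_on UNIV (\<lambda>Y :: state_value. Nm (fst (snd Y)))"
      by (rule continuous_on_compose2[OF Nm_cont]) (auto intro!: continuous_intros)
    show "closed {Y :: state_value. 0 \<le> snd (snd (snd Y)) \<and> Nm (fst (snd Y)) ^ 3 \<le> M x * snd (snd (snd Y))}"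
      by (intro closed_Collect_conj closed_Collect_le continuous_intros Nm_cont')
    \<comment> \<open>The cube of \<open>Nm\<close> is convex and, for fixed \<open>x\<close>,
      \<open>M x * w\<close> is linear in \<open>w\<close>, so the condition is convex whatever the
      sign of \<open>M x\<close>.\<close>
    show "convex {Y :: state_value. 0 \<le> snd (snd (snd Y)) \<and> Nm (fst (snd Y)) ^ 3 \<le> M x * snd (snd (snd Y))}"
      unfolding convex_alt
    proof (intro ballI allI impI CollectI conjI; elim CollectE conjE)
      fix Y1 Y2 :: state_value and t :: real
      assume t: "0 \<le> t" "t \<le> 1" and pos: "0 \<le> snd (snd (snd Y1))" "0 \<le> snd (snd (snd Y2))"
        and le: "Nm (fst (snd Y1)) ^ 3 \<le> M x * snd (snd (snd Y1))" "Nm (fst (snd Y2)) ^ 3 \<le> M x * snd (snd (snd Y2))"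
      show "0 \<le> snd (snd (snd ((1 - t) *\<^sub>R Y1 + t *\<^sub>R Y2)))" using t pos by simp
      have "Nm (fst (snd ((1 - t) *\<^sub>R Y1 + t *\<^sub>R Y2))) ^ 3
          \<le> (1 - t) * Nm (fst (snd Y1)) ^ 3 + t * Nm (fst (snd Y2)) ^ 3"
        using convex_onD[OF is_norm_convex_on_power[OF norms(2), of 3], of t "fst (snd Y1)" "fst (snd Y2)"] t by simp
      also have "\<dots> \<le> (1 - t) * (M x * snd (snd (snd Y1))) + t * (M x * snd (snd (snd Y2)))"
        using t le by (intro add_mono mult_left_mono) auto
      also have "\<dots> = M x * snd (snd (snd ((1 - t) *\<^sub>R Y1 + t *\<^sub>R Y2)))" by (simp add: algebra_simps)
      finally show "Nm (fst (snd ((1 - t) *\<^sub>R Y1 + t *\<^sub>R Y2))) ^ 3 \<le> M x * snd (snd (snd ((1 - t) *\<^sub>R Y1 + t *\<^sub>R Y2)))" .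
    qed
  next
    fix n
    show "AE x in ?T. U (\<mu> n) x \<in> {Y. 0 \<le> snd (snd (snd Y)) \<and> Nm (fst (snd Y)) ^ 3 \<le> M x * snd (snd (snd Y))}"
      using w_nonneg[of "\<mu> n"] distortion[of "\<mu> n"] by eventually_elim (simp add: U_def)
  qed
  have w_lim_nonneg: "AE x in ?T. 0 \<le> w x" and distortion_lim: "AE x in ?T. Nm (F x) ^ 3 \<le> M x * w x"
    using pointwise by (auto elim!: eventually_mono simp: U'_eq)

  \<comment> \<open>Lower semicontinuity of the functional\<close>
  define J' where "J' = (LINT x|?T. E.energy_density (v0 x) (U' x))"
  have J'_int: "integrable ?T (\<lambda>x. E.energy_density (v0 x) (U' x))"
    unfolding U'_eq using X_lim
    by (intro E.integrable_energy_density finite_measure_torus v0 w_lim_nonneg) (auto simp: space_X_def)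
  have I'_eq: "functional_I l Nv G v0 (v, F, Z, w) = ereal (J' + C2 * m)"
    unfolding J'_def m_def U'_eq by (rule E.functional_I_eq[OF v0 X_lim w_lim_nonneg])
  have liminf_le: "liminf I \<le> ereal K"
  proof -
    have "liminf I \<le> limsup I" by (rule Liminf_le_Limsup) simp
    also have "\<dots> \<le> ereal K" using order.trans[OF I_le K] by (intro Limsup_bounded) auto
    finally show ?thesis .
  qed
  \<comment> \<open>Nonnegativity of the shifted energies bounds the lower limit from below, which
    makes it a real number \<open>L\<close>.\<close>
  moreover have "ereal (C2 * m) \<le> liminf I"
    using J_nonneg by (intro Liminf_bounded) (auto simp: I_eq)
  ultimately obtain L where L: "liminf I = ereal L" by (cases "liminf I") auto
  have "((I \<circ> \<rho>) \<circ> \<nu>) \<longlonglongrightarrow> ereal L" using LIMSEQ_subseq_LIMSEQ[OF \<rho>(2) \<nu>] by (simp add: L)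
  hence J_lim: "(\<lambda>n. J (\<mu> n) + C2 * m) \<longlonglongrightarrow> L" by (simp add: comp_def I_eq \<mu>_def)
  have "J' + C2 * m \<le> L"
  proof (rule field_le_epsilon)
    fix e :: real assume e: "0 < e"
    have "eventually (\<lambda>n. J (\<mu> n) + C2 * m < L + e) sequentially"
      using J_lim e by (intro order_tendstoD) auto
    then obtain N where N: "\<And>n. n \<ge> N \<Longrightarrow> J (\<mu> n) + C2 * m < L + e" by (auto simp: eventually_sequentially)
    \<comment> \<open>Bounds the shifted energies from index \<open>N\<close> on, which is why the
      tail of the sequence is used below.\<close>
    define b where "b = L + e - C2 * m"
    have J_b: "J (\<mu> (n + N)) \<le> b" for n using N[of "n + N"] by (simp add: b_def)
    have b0: "0 \<le> b" using J_b[of 0] J_nonneg[of "\<mu> (0 + N)"] by linarith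
    have "(\<integral>\<^sup>+x. ennreal (E.energy_density (v0 x) (U' x)) \<partial>?T) \<le> ennreal b"
    proof (rule T.weak_lsc_convex_integral[where u="\<lambda>n. U (\<mu> (n + N))" and S="{Y :: state_value. 0 \<le> snd (snd (snd Y))}"
        and f="\<lambda>x. E.energy_density (v0 x)", OF U U_bound U'])
      show "(\<lambda>n. LINT x|?T. U (\<mu> (n + N)) x \<bullet> g x) \<longlonglongrightarrow> (LINT x|?T. U' x \<bullet> g x)" if "g \<in> Lsp ?T 2" for g
        using LIMSEQ_ignore_initial_segment[OF U_lim[OF that], of N] by simp
      show "closed {Y :: state_value. 0 \<le> snd (snd (snd Y))}"
        by (intro closed_Collect_le continuous_intros)
      show "AE x in ?T. U (\<mu> (n + N)) x \<in> {Y :: state_value. 0 \<le> snd (snd (snd Y))}" for n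
        using w_nonneg[of "\<mu> (n + N)"] by (simp add: U_def)
      show "(\<lambda>x. E.energy_density (v0 x) (U (\<mu> (n + N)) x)) \<in> borel_measurable ?T" for n
        by (intro E.measurable_energy_density LspD(1)[OF v0] LspD(1)[OF U])
      show "(\<integral>\<^sup>+x. ennreal (E.energy_density (v0 x) (U (\<mu> (n + N)) x)) \<partial>?T) \<le> ennreal b" for n
      proof -
        have "(\<integral>\<^sup>+x. ennreal (E.energy_density (v0 x) (U (\<mu> (n + N)) x)) \<partial>?T) = ennreal (J (\<mu> (n + N)))"
          unfolding J_def U_def by (intro nn_integral_eq_integral J_int) (simp add: E.energy_density_nonneg)
        thus ?thesis by (simp only: ennreal_leI[OF J_b])
      qed
    qed (rule E.convex_on_energy_density E.continuous_on_energy_density E.energy_density_nonneg)+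
    moreover have "(\<integral>\<^sup>+x. ennreal (E.energy_density (v0 x) (U' x)) \<partial>?T) = ennreal J'"
      unfolding J'_def by (intro nn_integral_eq_integral J'_int) (simp add: E.energy_density_nonneg)
    ultimately have "J' \<le> b" using b0 by simp
    thus "J' + C2 * m \<le> L + e" by (simp add: b_def)
  qed
  hence lsc: "functional_I l Nv G v0 (v, F, Z, w) \<le> liminf I" by (simp add: I'_eq L)

  \<comment> \<open>The linear constraints for the limit\<close>
  have F0_2: "F0 \<in> Lsp ?T 2" using T.Lsp_mono(1)[OF initial_data(4), of 2] exponents by simp
  have Z0_2: "Z0 \<in> Lsp ?T 2" using T.Lsp_mono(1)[OF initial_data(6), of 2] exponents by simp
  have w0_2: "w0 \<in> Lsp ?T 2" using T.Lsp_mono(1)[OF initial_data(8), of 2] exponents by simp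
  \<comment> \<open>As a quadratic expression in \<open>F0\<close>, the cofactor matrix would
    inherit only the exponent \<open>p / 2\<close>, which may be below 2; membership in L2 comes
    from \<open>Z0\<close> and \<open>q \<ge> 2\<close>.\<close>
  have cof_2: "(\<lambda>x. cof (F0 x)) \<in> Lsp ?T 2"
  proof (rule LspI_bound[OF _ LspD(2)[OF Z0_2]])
    show "(\<lambda>x. cof (F0 x)) \<in> borel_measurable ?T"
      by (rule measurable_compose[OF LspD(1)[OF F0_2] borel_measurable_continuous_onI[OF continuous_on_cof]])
    show "AE x in ?T. norm (cof (F0 x)) powr 2 \<le> norm (Z0 x) powr 2"
      using initial_data(5) by eventually_elim simp
  qed
  have constraints: "(LINT x|?T. \<theta> x * (1/h * (F x $ i $ a - F0 x $ i $ a))) = - (LINT x|?T. v x $ i * pd a \<theta> x)"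
    "(LINT x|?T. \<theta> x * (1/h * (Z x $ k $ c - Z0 x $ k $ c))) =
               - (LINT x|?T. (\<Sum>i\<in>UNIV. \<Sum>j\<in>UNIV. \<Sum>a\<in>UNIV. \<Sum>b\<in>UNIV.
                    perm_symbol i j k * perm_symbol a b c * F0 x $ j $ b * v x $ i * pd a \<theta> x))"
    "(LINT x|?T. \<theta> x * (1/h * (w x - w0 x))) =
          - (LINT x|?T. (\<Sum>i\<in>UNIV. \<Sum>a\<in>UNIV. cof (F0 x) $ i $ a * v x $ i * pd a \<theta> x))"
    if \<theta>: "\<theta> \<in> test_functions l" for \<theta> i a k c
  proof -
    obtain B where \<theta>_meas: "\<theta> \<in> borel_measurable ?T" "AE x in ?T. \<bar>\<theta> x\<bar> \<le> B"
      using continuous_on_test_function(1)[OF \<theta>] by (rule continuous_measurable_bounded_on_torus)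
    have mult: "(\<lambda>x. f x * pd a \<theta> x) \<in> Lsp ?T 2" if "f \<in> Lsp ?T 2" for f a
      by (rule Lsp_torus_continuous_mult[OF continuous_on_test_function(2)[OF \<theta>] that])
    have entry: "Y \<bullet> axis k (axis c 1) = Y $ k $ c" for Y :: "real^3^3" and k c
      by (simp add: inner_axis)
    \<comment> \<open>Each right-hand side is the pairing of \<open>v\<close> with one of the fixed
      fields \<open>?g1\<close>, \<open>?g2\<close>, \<open>?g3\<close>. These lie in L2 because the
      derivatives of \<open>\<theta>\<close> are bounded on the cell.\<close>
    let ?g1 = "\<lambda>x. \<chi> i'. if i' = i then pd a \<theta> x else 0"
    have g1: "?g1 \<in> Lsp ?T 2"
    proof (rule Lsp_vecI)
      fix i'
      have "(\<lambda>x. 1 * pd a \<theta> x) \<in> Lsp ?T 2" by (rule mult, rule T.Lsp_bounded[where B=1]) auto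
      thus "(\<lambda>x. ?g1 x $ i') \<in> Lsp ?T 2" by (cases "i' = i") auto
    qed simp
    have g1_inner: "y $ i * pd a \<theta> x = y \<bullet> ?g1 x" for x y
      by (simp add: inner_vec_def if_distrib cong: if_cong)
    show "(LINT x|?T. \<theta> x * (1/h * (F x $ i $ a - F0 x $ i $ a))) = - (LINT x|?T. v x $ i * pd a \<theta> x)"
    proof -
      have "(LINT x|?T. \<theta> x * (1/h * (F x \<bullet> axis i (axis a 1) - F0 x \<bullet> axis i (axis a 1)))) = - (LINT x|?T. v x \<bullet> ?g1 x)"
      proof (rule T.integral_constraint_weak_limit[OF F2(1) F_L2 F0_2 g1 \<theta>_meas F_lim v_lim])
        show "(LINT x|?T. \<theta> x * (1/h * (Fs (\<mu> n) x \<bullet> axis i (axis a 1) - F0 x \<bullet> axis i (axis a 1)))) = - (LINT x|?T. vs (\<mu> n) x \<bullet> ?g1 x)" for n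
          unfolding entry g1_inner[symmetric] by (rule constraint_F[OF \<theta>])
      qed
      thus ?thesis unfolding entry g1_inner[symmetric] .
    qed
    let ?g2 = "\<lambda>x. \<chi> i. \<Sum>j\<in>UNIV. \<Sum>a\<in>UNIV. \<Sum>b\<in>UNIV. (perm_symbol i j k * perm_symbol a b c) *\<^sub>R (F0 x $ j $ b * pd a \<theta> x)"
    have g2: "?g2 \<in> Lsp ?T 2"
    proof (rule Lsp_vecI)
      show "(\<lambda>x. ?g2 x $ i) \<in> Lsp ?T 2" for i
        unfolding vec_lambda_beta by (intro Lsp_sum Lsp_scaleR mult Lsp_vec_nth F0_2) auto
    qed simp
    have g2_inner: "(\<Sum>i\<in>UNIV. \<Sum>j\<in>UNIV. \<Sum>a\<in>UNIV. \<Sum>b\<in>UNIV.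
        perm_symbol i j k * perm_symbol a b c * F0 x $ j $ b * y $ i * pd a \<theta> x) = y \<bullet> ?g2 x" for x y
      by (simp add: inner_vec_def sum_distrib_left mult_ac)
    show "(LINT x|?T. \<theta> x * (1/h * (Z x $ k $ c - Z0 x $ k $ c))) =
               - (LINT x|?T. (\<Sum>i\<in>UNIV. \<Sum>j\<in>UNIV. \<Sum>a\<in>UNIV. \<Sum>b\<in>UNIV.
                    perm_symbol i j k * perm_symbol a b c * F0 x $ j $ b * v x $ i * pd a \<theta> x))"
    proof -
      have "(LINT x|?T. \<theta> x * (1/h * (Z x \<bullet> axis k (axis c 1) - Z0 x \<bullet> axis k (axis c 1)))) = - (LINT x|?T. v x \<bullet> ?g2 x)"
      proof (rule T.integral_constraint_weak_limit[OF Z2(1) Z_L2 Z0_2 g2 \<theta>_meas Z_lim v_lim])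
        show "(LINT x|?T. \<theta> x * (1/h * (Zs (\<mu> n) x \<bullet> axis k (axis c 1) - Z0 x \<bullet> axis k (axis c 1)))) = - (LINT x|?T. vs (\<mu> n) x \<bullet> ?g2 x)" for n
          unfolding entry g2_inner[symmetric] by (rule constraint_Z[OF \<theta>])
      qed
      thus ?thesis unfolding entry g2_inner[symmetric] .
    qed
    let ?g3 = "\<lambda>x. \<chi> i. \<Sum>a\<in>UNIV. cof (F0 x) $ i $ a * pd a \<theta> x"
    have g3: "?g3 \<in> Lsp ?T 2"
    proof (rule Lsp_vecI)
      show "(\<lambda>x. ?g3 x $ i) \<in> Lsp ?T 2" for i
        unfolding vec_lambda_beta by (intro Lsp_sum mult Lsp_vec_nth cof_2) auto
    qed simp
    have g3_inner: "(\<Sum>i\<in>UNIV. \<Sum>a\<in>UNIV. cof (F0 x) $ i $ a * y $ i * pd a \<theta> x) = y \<bullet> ?g3 x" for x y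
      by (simp add: inner_vec_def sum_distrib_left mult_ac)
    have one: "y \<bullet> 1 = y" for y :: real by simp
    show "(LINT x|?T. \<theta> x * (1/h * (w x - w0 x))) =
          - (LINT x|?T. (\<Sum>i\<in>UNIV. \<Sum>a\<in>UNIV. cof (F0 x) $ i $ a * v x $ i * pd a \<theta> x))"
    proof -
      have "(LINT x|?T. \<theta> x * (1/h * (w x \<bullet> 1 - w0 x \<bullet> 1))) = - (LINT x|?T. v x \<bullet> ?g3 x)"
      proof (rule T.integral_constraint_weak_limit[OF w2(1) w_L2 w0_2 g3 \<theta>_meas w_lim v_lim])
        show "(LINT x|?T. \<theta> x * (1/h * (ws (\<mu> n) x \<bullet> 1 - w0 x \<bullet> 1))) = - (LINT x|?T. vs (\<mu> n) x \<bullet> ?g3 x)" for n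
          unfolding one g3_inner[symmetric] by (rule constraint_w[OF \<theta>])
      qed
      thus ?thesis unfolding one g3_inner[symmetric] .
    qed
  qed
  \<comment> \<open>Finiteness of the functional at the limit is contained in \<open>I'_eq\<close>,
    whose right-hand side is a real number.\<close>
  have "(v, F, Z, w) \<in> admissible l Nv Nm G h p q r M v0 F0 Z0 w0"
    unfolding admissible_def
    using X_lim I'_eq w_lim_nonneg distortion_lim constraints by simp
  moreover have "liminf I < \<infinity>" by (simp add: L)
  ultimately show ?thesis
    using X_lim \<mu> v_weak F_weak Z_weak w_weak lsc unfolding I_def by blast
qed

end
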